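(* Consider bootstrap percolation on $\mathbb{Z}^2\times K_n$ with fixed threshold $\theta\ge 3$, where each vertex is initially occupied independently with probability $p=a/n$ for some $a\in(0,\infty)$. Let $v_0$ be an arbitrary fixed vertex. Then both $\liminf_{n\to\infty}\mathbb{P}_p(\omega_\infty(v_0)=1)$ and $\limsup_{n\to\infty}\mathbb{P}_p(\omega_\infty(v_0)=1)$ are in $(0,1)$, and both converge to $0$ as $a\to 0$ and to $1$ as $a\to\infty$. If $\theta\ge 14$, then $\lim_{n\to\infty}\mathbb{P}_p(\omega_\infty(v_0)=1)$ exists and is continuous in $a\in(0,\infty)$.
   Context: $K_n$ is the complete graph on $n$ vertices, and $\mathbb{Z}^2\times K_n$ is the Cartesian graph product: $(x,u)$ and $(x',u')$ are adjacent iff either $x=x'$ and $u\ne u'$, or $u=u'$ and $x,x'$ are nearest neighbors in $\mathbb{Z}^2$. Bootstrap percolation with integer threshold $\theta$ on a graph: $\omega_0$ is the set of initially occupied vertices; given $\omega_t$, $\omega_{t+1}$ consists of $\omega_t$ together with all vertices having at least $\theta$ neighbors in $\omega_t$; $\omega_\infty=\bigcup_{t\ge0}\omega_t$. Sets are identified with their indicator functions, so $\omega_\infty(v)=1$ means $v\in\omega_\infty$. $\mathbb{P}_p$ denotes probability when $\omega_0$ is a product measure in which every vertex is occupied independently with probability $p$. *)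

theory Defs
  imports "HOL-Probability.Probability"
begin

type_synonym vertex = "(int \<times> int) \<times> nat"

definition Z2_adj :: "int \<times> int \<Rightarrow> int \<times> int \<Rightarrow> bool" where
  "Z2_adj x y \<longleftrightarrow> \<bar>fst x - fst y\<bar> + \<bar>snd x - snd y\<bar> = 1"

text \<open>The complete graph \<open>K\<^sub>n\<close> has the vertices \<open>0, \<dots>, n - 1\<close>.\<close>

definition vertices :: "nat \<Rightarrow> vertex set" where
  "vertices n = UNIV \<times> {..<n}"

definition adj :: "nat \<Rightarrow> vertex \<Rightarrow> vertex \<Rightarrow> bool" where
  "adj n v w \<longleftrightarrow> v \<in> vertices n \<and> w \<in> vertices n \<and>
     (fst v = fst w \<and> snd v \<noteq> snd w \<or> snd v = snd w \<and> Z2_adj (fst v) (fst w))"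

text \<open>Bootstrap percolation on the graph with vertex set \<open>V\<close> and adjacency relation \<open>E\<close>.
  Cardinalities of infinite sets are \<open>0\<close>, so this is meant for locally finite graphs only.\<close>

primrec bootstrap ::
  "'v set \<Rightarrow> ('v \<Rightarrow> 'v \<Rightarrow> bool) \<Rightarrow> nat \<Rightarrow> 'v set \<Rightarrow> nat \<Rightarrow> 'v set" where
  "bootstrap V E \<theta> \<omega>\<^sub>0 0 = \<omega>\<^sub>0"
| "bootstrap V E \<theta> \<omega>\<^sub>0 (Suc t) = bootstrap V E \<theta> \<omega>\<^sub>0 t \<union>
     {v \<in> V. \<theta> \<le> card {w \<in> bootstrap V E \<theta> \<omega>\<^sub>0 t. E v w}}"

definition bootstrap_limit ::
  "'v set \<Rightarrow> ('v \<Rightarrow> 'v \<Rightarrow> bool) \<Rightarrow> nat \<Rightarrow> 'v set \<Rightarrow> 'v set" where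
  "bootstrap_limit V E \<theta> \<omega>\<^sub>0 = (\<Union>t. bootstrap V E \<theta> \<omega>\<^sub>0 t)"

text \<open>Initial configurations are given by their indicator functions. Note that
  \<^const>\<open>bernoulli_pmf\<close> truncates its parameter to the unit interval.\<close>

definition initial_law :: "nat \<Rightarrow> real \<Rightarrow> (vertex \<Rightarrow> bool) measure" where
  "initial_law n p = Pi\<^sub>M (vertices n) (\<lambda>_. measure_pmf (bernoulli_pmf p))"

definition prob_occupied :: "nat \<Rightarrow> nat \<Rightarrow> real \<Rightarrow> vertex \<Rightarrow> real" where
  "prob_occupied n \<theta> p v = measure (initial_law n p)
     {\<eta> \<in> space (initial_law n p).
        v \<in> bootstrap_limit (vertices n) (adj n) \<theta> {w \<in> vertices n. \<eta> w}}"

end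

theory Submission
  imports Defs
begin

text \<open>Call the \<open>n\<close> vertices above a point \<open>x\<close> of \<open>\<int>\<^sup>2\<close> its fibre, and let \<open>N x\<close> be the number of them that are
  initially occupied. A vertex sees its own fibre and at most four vertices outside it. Hence a fibre with
  \<open>N x \<ge> \<theta>\<close> fills up at once, and a fibre with \<open>N x \<le> \<theta> - 5\<close> never gains a vertex. As \<open>n \<rightarrow> \<infinity>\<close> with
  \<open>p = a / n\<close>, the counts \<open>N x\<close> become independent Poisson variables of mean \<open>a\<close>.

  The first half of the theorem needs two crude bounds. The vertex \<open>v\<^sub>0\<close> becomes occupied if its fibre has
  \<open>N \<ge> \<theta>\<close> (\<open>occupation_lower_bound\<close>). It stays empty if the four fibres above a unit square are initially empty,
  because every vertex of such a block has only two neighbours outside the block and \<open>\<theta> \<ge> 3\<close>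
  (\<open>occupation_upper_bound\<close>). Both bounds have explicit limits in \<open>(0,1)\<close>; the
  upper one tends to \<open>0\<close> as \<open>a \<rightarrow> 0\<close> and the lower one tends to \<open>1\<close> as \<open>a \<rightarrow> \<infinity>\<close>.

  For \<open>\<theta> \<ge> 14\<close>, compare the process with the one started only from the occupied vertices above a ball of radius
  \<open>R\<close> about the base point of \<open>v\<^sub>0\<close>. With high probability no two occupied vertices above the ball share their
  \<open>K\<^sub>n\<close>-coordinate, with each other or with \<open>v\<^sub>0\<close>. On that event the outcome of the local process depends only
  on the counts in the ball, and for large \<open>n\<close> no longer on \<open>n\<close> (\<open>local_outcome_determined\<close>): its probability
  converges to a finite-dimensional Poisson probability, continuous in \<open>a\<close>. If the two processes disagree at
  \<open>v\<^sub>0\<close>, the points whose fibres differ at the end contain a connected set from the centre to the boundary of the ball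
  (\<open>far_influence_needs_path\<close>). All counts on it lie in \<open>{\<theta> - 4..\<theta> - 1}\<close>; the value \<open>\<theta> - 1\<close> is excluded as
  well, since one occupied vertex in an adjacent fibre then suffices to fill the fibre. A shortest path in this set
  has no shortcuts, so it never reverses and never makes two equal turns in a row. There are at most
  \<open>6 \<cdot> (5/2)\<^sup>R\<close> such paths (\<open>card_path_codes\<close>), whereas a Poisson variable lies in the three-point window
  \<open>{\<theta> - 4..\<theta> - 2}\<close> with probability at most \<open>39/100\<close>, whatever its mean (\<open>poisson_window\<close>). As
  \<open>5/2 \<cdot> 39/100 < 1\<close>, disagreement becomes unlikely as \<open>R\<close> grows, and the occupation probability is
  squeezed between continuous functions of \<open>a\<close> whose gap is arbitrarily small; this gives both convergence and
  continuity (\<open>continuous_limit_from_approximations\<close>).\<close>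

section \<open>The final configuration as a least closed set\<close>

lemma bootstrap_subset_limit: "bootstrap V E \<theta> \<omega> t \<subseteq> bootstrap_limit V E \<theta> \<omega>"
  by (auto simp: bootstrap_limit_def)

lemma initial_subset_limit: "\<omega> \<subseteq> bootstrap_limit V E \<theta> \<omega>"
  using bootstrap_subset_limit[of V E \<theta> \<omega> 0] by simp

lemma bootstrap_mono_time: "s \<le> t \<Longrightarrow> bootstrap V E \<theta> \<omega> s \<subseteq> bootstrap V E \<theta> \<omega> t"
  by (rule lift_Suc_mono_le[of "bootstrap V E \<theta> \<omega>"]) auto

text \<open>A vertex with \<open>\<theta>\<close> finally occupied neighbours sees all of them occupied at some finite time, because it
  has finitely many neighbours. Together with minimality below, this replaces all reasoning about time: two
  final configurations are compared by exhibiting closed sets.\<close>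
lemma bootstrap_limit_closed:
  assumes fin: "finite {w. E v w}" and "v \<in> V"
    and card: "\<theta> \<le> card {w \<in> bootstrap_limit V E \<theta> \<omega>. E v w}"
  shows "v \<in> bootstrap_limit V E \<theta> \<omega>"
proof -
  let ?b = "bootstrap V E \<theta> \<omega>" and ?N = "{w \<in> bootstrap_limit V E \<theta> \<omega>. E v w}"
  have finN: "finite ?N"
    by (rule finite_subset[OF _ fin]) auto
  have "\<forall>w\<in>?N. \<exists>t. w \<in> ?b t"
    by (auto simp: bootstrap_limit_def)
  then obtain \<tau> where \<tau>: "\<And>w. w \<in> ?N \<Longrightarrow> w \<in> ?b (\<tau> w)"
    by metis
  define t where "t = Max (insert 0 (\<tau> ` ?N))"
  have "\<tau> w \<le> t" if "w \<in> ?N" for w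
    unfolding t_def using finN that by (intro Max_ge) auto
  then have "w \<in> ?b t" if "w \<in> ?N" for w
    using bootstrap_mono_time \<tau>[OF that] that by (meson subsetD)
  then have "?N \<subseteq> {w \<in> ?b t. E v w}"
    by auto
  moreover have "finite {w \<in> ?b t. E v w}"
    by (rule finite_subset[OF _ fin]) auto
  ultimately have "card ?N \<le> card {w \<in> ?b t. E v w}"
    by (intro card_mono)
  then have "\<theta> \<le> card {w \<in> ?b t. E v w}"
    using card by simp
  then have "v \<in> ?b (Suc t)"
    using \<open>v \<in> V\<close> by simp
  then show ?thesis
    by (rule subsetD[OF bootstrap_subset_limit])
qed

lemma bootstrap_limit_least:
  assumes fin: "\<And>v. v \<in> V \<Longrightarrow> finite {w. E v w}" and init: "\<omega> \<subseteq> W"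
    and closed: "\<And>v. v \<in> V \<Longrightarrow> \<theta> \<le> card {w \<in> W. E v w} \<Longrightarrow> v \<in> W"
  shows "bootstrap_limit V E \<theta> \<omega> \<subseteq> W"
proof -
  have "bootstrap V E \<theta> \<omega> t \<subseteq> W" for t
  proof (induction t)
    case 0
    then show ?case using init by simp
  next
    case (Suc t)
    have "v \<in> W" if "v \<in> V" "\<theta> \<le> card {w \<in> bootstrap V E \<theta> \<omega> t. E v w}" for v
    proof (rule closed[OF that(1)])
      have "finite {w \<in> W. E v w}"
        by (rule finite_subset[OF _ fin[OF that(1)]]) auto
      then show "\<theta> \<le> card {w \<in> W. E v w}"
        using that(2) Suc by (elim order_trans) (auto intro!: card_mono)
    qed
    then show ?case using Suc by auto
  qed
  then show ?thesis by (auto simp: bootstrap_limit_def)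
qed

section \<open>Fibres\<close>

abbreviation occupied :: "nat \<Rightarrow> nat \<Rightarrow> vertex set \<Rightarrow> vertex set" where
  "occupied n \<theta> \<omega> \<equiv> bootstrap_limit (vertices n) (adj n) \<theta> \<omega>"

text \<open>Only the \<open>K\<^sub>n\<close>-coordinates are kept, so that fibres above different points can be intersected.\<close>
definition fibre :: "nat \<Rightarrow> vertex set \<Rightarrow> int \<times> int \<Rightarrow> nat set" where
  "fibre n \<omega> x = {u. u < n \<and> (x, u) \<in> \<omega>}"

lemma finite_fibre [simp]: "finite (fibre n \<omega> x)"
  by (simp add: fibre_def)

lemma Z2_adj_sym: "Z2_adj x y \<longleftrightarrow> Z2_adj y x"
  by (auto simp: Z2_adj_def)

lemma Z2_adj_irrefl [simp]: "\<not> Z2_adj x x"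
  by (auto simp: Z2_adj_def)

lemma Z2_adj_iff: "Z2_adj x y \<longleftrightarrow> y - x \<in> {(1,0), (-1,0), (0,1), (0,-1)}"
  by (cases x; cases y) (auto simp: Z2_adj_def)

lemma Z2_adj_Pair: "Z2_adj (a, b) z \<longleftrightarrow> z \<in> {(a + 1, b), (a - 1, b), (a, b + 1), (a, b - 1)}"
  by (cases z) (auto simp: Z2_adj_def)

lemma Z2_neighbours: "{y. Z2_adj x y} = (\<lambda>d. x + d) ` {(1,0), (-1,0), (0,1), (0,-1)}"
  by (cases x) (auto simp: Z2_adj_def image_iff)

lemma finite_Z2_neighbours [simp]: "finite {y. Z2_adj x y}" "finite {y. Z2_adj x y \<and> P y}"
proof -
  show "finite {y. Z2_adj x y}" by (simp add: Z2_neighbours)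
  then show "finite {y. Z2_adj x y \<and> P y}" by (rule rev_finite_subset) auto
qed

lemma card_Z2_neighbours: "card {y. Z2_adj x y \<and> P y} \<le> 4"
proof -
  have "card {y. Z2_adj x y \<and> P y} \<le> card {y. Z2_adj x y}"
    by (intro card_mono) auto
  also have "\<dots> \<le> card {(1,0), (-1,0), (0,1), (0,-1::int) :: int \<times> int}"
    unfolding Z2_neighbours by (rule card_image_le) simp
  finally show ?thesis by (simp add: card_insert_if)
qed

lemma neighbours_split:
  assumes "u < n"
  shows "{w \<in> A. adj n (x, u) w} =
    Pair x ` (fibre n A x - {u}) \<union> (\<lambda>y. (y, u)) ` {y. Z2_adj x y \<and> (y, u) \<in> A}"
  using assms by (auto simp: adj_def vertices_def fibre_def image_iff)

lemma finite_neighbours: "finite {w. adj n v w}"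
proof (cases "v \<in> vertices n")
  case True
  then obtain x u where v: "v = (x, u)" "u < n"
    by (auto simp: vertices_def)
  have "finite (Pair x ` (fibre n UNIV x - {u}) \<union> (\<lambda>y. (y, u)) ` {y. Z2_adj x y \<and> (y, u) \<in> UNIV})"
    by (intro finite_UnI finite_imageI finite_Z2_neighbours finite_Diff finite_fibre)
  then show ?thesis
    unfolding neighbours_split[OF v(2), symmetric] v(1) by simp
next
  case False
  then show ?thesis by (simp add: adj_def)
qed

text \<open>The bootstrap rule in product form: neighbours in the own fibre, plus at most four vertices with the same
  \<open>K\<^sub>n\<close>-coordinate.\<close>
lemma card_neighbours:
  assumes "u < n"
  shows "card {w \<in> A. adj n (x, u) w} =
    card (fibre n A x - {u}) + card {y. Z2_adj x y \<and> (y, u) \<in> A}"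
proof -
  let ?C = "fibre n A x - {u}" and ?S = "{y. Z2_adj x y \<and> (y, u) \<in> A}"
  have "card (Pair x ` ?C \<union> (\<lambda>y. (y, u)) ` ?S) = card (Pair x ` ?C) + card ((\<lambda>y. (y, u)) ` ?S)"
    by (intro card_Un_disjoint finite_imageI finite_Diff finite_fibre finite_Z2_neighbours) auto
  then show ?thesis
    by (simp only: neighbours_split[OF assms]) (simp add: card_image inj_on_def)
qed

lemma occupied_closed:
  assumes "u < n" "\<theta> \<le> card (fibre n (occupied n \<theta> \<omega>) x - {u}) +
    card {y. Z2_adj x y \<and> (y, u) \<in> occupied n \<theta> \<omega>}"
  shows "(x, u) \<in> occupied n \<theta> \<omega>"
proof (rule bootstrap_limit_closed[OF finite_neighbours])
  show "\<theta> \<le> card {w \<in> occupied n \<theta> \<omega>. adj n (x, u) w}"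
    unfolding card_neighbours[OF assms(1)] by (rule assms(2))
  show "(x, u) \<in> vertices n"
    using assms(1) by (simp add: vertices_def)
qed

lemma occupied_least:
  assumes "\<omega> \<subseteq> W"
    and "\<And>x u. u < n \<Longrightarrow>
      \<theta> \<le> card (fibre n W x - {u}) + card {y. Z2_adj x y \<and> (y, u) \<in> W} \<Longrightarrow> (x, u) \<in> W"
  shows "occupied n \<theta> \<omega> \<subseteq> W"
proof (rule bootstrap_limit_least[OF finite_neighbours assms(1)])
  fix v assume "v \<in> vertices n" "\<theta> \<le> card {w \<in> W. adj n v w}"
  moreover from this(1) obtain x u where "v = (x, u)" "u < n"
    by (auto simp: vertices_def)
  ultimately show "v \<in> W"
    using assms(2)[of u x] card_neighbours[of u n W x] by simp
qed

lemma occupied_mono: "\<omega> \<subseteq> \<omega>' \<Longrightarrow> occupied n \<theta> \<omega> \<subseteq> occupied n \<theta> \<omega>'"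
  by (rule occupied_least[OF order_trans[OF _ initial_subset_limit]], assumption,
      rule occupied_closed)

lemma fibre_full:
  assumes "\<theta> \<le> card (fibre n (occupied n \<theta> \<omega>) x)" "u < n"
  shows "(x, u) \<in> occupied n \<theta> \<omega>"
proof (cases "u \<in> fibre n (occupied n \<theta> \<omega>) x")
  case False
  then show ?thesis using assms by (intro occupied_closed) auto
qed (simp add: fibre_def)

lemma fibre_initially_full:
  assumes "\<theta> \<le> card (fibre n \<omega> x)" "u < n"
  shows "(x, u) \<in> occupied n \<theta> \<omega>"
proof (rule fibre_full[OF _ assms(2)])
  have "fibre n \<omega> x \<subseteq> fibre n (occupied n \<theta> \<omega>) x"
    using initial_subset_limit[of \<omega>] by (auto simp: fibre_def)
  then have "card (fibre n \<omega> x) \<le> card (fibre n (occupied n \<theta> \<omega>) x)"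
    by (rule card_mono[OF finite_fibre])
  with assms(1) show "\<theta> \<le> card (fibre n (occupied n \<theta> \<omega>) x)"
    by simp
qed

text \<open>The first vertex gained by the fibre of \<open>x\<close> would have at most \<open>N x + 4 < \<theta>\<close> occupied neighbours; formally,
  deleting all gained vertices of this fibre from the final configuration leaves a closed set.\<close>
lemma fibre_inert:
  assumes "card (fibre n \<omega> x) + 4 < \<theta>" "(x, u) \<in> occupied n \<theta> \<omega>"
  shows "(x, u) \<in> \<omega>"
proof -
  define W where "W = {w \<in> occupied n \<theta> \<omega>. fst w = x \<longrightarrow> w \<in> \<omega>}"
  have "occupied n \<theta> \<omega> \<subseteq> W"
  proof (rule occupied_least)
    show "\<omega> \<subseteq> W"
      using initial_subset_limit[of \<omega>] by (auto simp: W_def)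
    fix y v
    assume v: "v < n" "\<theta> \<le> card (fibre n W y - {v}) + card {z. Z2_adj y z \<and> (z, v) \<in> W}"
    have "y \<noteq> x"
    proof
      assume "y = x"
      have "card (fibre n W x - {v}) \<le> card (fibre n \<omega> x)"
        by (intro card_mono) (auto simp: fibre_def W_def)
      with card_Z2_neighbours[of x "\<lambda>z. (z, v) \<in> W"] v(2)[unfolded \<open>y = x\<close>] assms(1) show False
        by linarith
    qed
    moreover have "(y, v) \<in> occupied n \<theta> \<omega>"
    proof (rule occupied_closed[OF v(1)], rule order_trans[OF v(2)], rule add_mono)
      show "card (fibre n W y - {v}) \<le> card (fibre n (occupied n \<theta> \<omega>) y - {v})"
        by (intro card_mono) (auto simp: fibre_def W_def)
      show "card {z. Z2_adj y z \<and> (z, v) \<in> W} \<le> card {z. Z2_adj y z \<and> (z, v) \<in> occupied n \<theta> \<omega>}"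
        by (intro card_mono) (auto simp: W_def)
    qed
    ultimately show "(y, v) \<in> W" by (simp add: W_def)
  qed
  then show ?thesis using assms(2) by (auto simp: W_def)
qed

text \<open>The same argument for a whole block: a vertex above \<open>Q\<close> receives help only from outside \<open>Q\<close>.\<close>
lemma empty_region_stays_empty:
  assumes empty: "\<And>x. x \<in> Q \<Longrightarrow> fibre n \<omega> x = {}"
    and few: "\<And>x. x \<in> Q \<Longrightarrow> card {y. Z2_adj x y \<and> y \<notin> Q} < \<theta>"
    and "x \<in> Q" "u < n"
  shows "(x, u) \<notin> occupied n \<theta> \<omega>"
proof -
  define W where "W = {w \<in> occupied n \<theta> \<omega>. fst w \<in> Q \<longrightarrow> \<not> snd w < n}"
  have "occupied n \<theta> \<omega> \<subseteq> W"
  proof (rule occupied_least)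
    show "\<omega> \<subseteq> W"
      using initial_subset_limit[of \<omega>] empty by (auto simp: W_def fibre_def)
    fix y v
    assume v: "v < n" "\<theta> \<le> card (fibre n W y - {v}) + card {z. Z2_adj y z \<and> (z, v) \<in> W}"
    have "y \<notin> Q"
    proof
      assume "y \<in> Q"
      then have "fibre n W y = {}"
        by (auto simp: fibre_def W_def)
      moreover have "card {z. Z2_adj y z \<and> (z, v) \<in> W} \<le> card {z. Z2_adj y z \<and> z \<notin> Q}"
        using v(1) by (intro card_mono) (auto simp: W_def)
      ultimately show False using v(2) few[OF \<open>y \<in> Q\<close>] by simp
    qed
    moreover have "(y, v) \<in> occupied n \<theta> \<omega>"
    proof (rule occupied_closed[OF v(1)], rule order_trans[OF v(2)], rule add_mono)
      show "card (fibre n W y - {v}) \<le> card (fibre n (occupied n \<theta> \<omega>) y - {v})"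
        by (intro card_mono) (auto simp: fibre_def W_def)
      show "card {z. Z2_adj y z \<and> (z, v) \<in> W} \<le> card {z. Z2_adj y z \<and> (z, v) \<in> occupied n \<theta> \<omega>}"
        by (intro card_mono) (auto simp: W_def)
    qed
    ultimately show "(y, v) \<in> W" by (simp add: W_def)
  qed
  then show ?thesis using assms(3,4) by (auto simp: W_def)
qed

definition square :: "int \<times> int \<Rightarrow> (int \<times> int) set" where
  "square x = (\<lambda>d. x + d) ` {(0,0), (1,0), (0,1), (1,1)}"

lemma empty_square_stays_empty:
  assumes "\<theta> \<ge> 3" "\<And>y. y \<in> square x \<Longrightarrow> fibre n \<omega> y = {}" "u < n"
  shows "(x, u) \<notin> occupied n \<theta> \<omega>"
proof (rule empty_region_stays_empty[of "square x"])
  show "x \<in> square x" by (cases x) (simp add: square_def)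
  fix y assume "y \<in> square x"
  then have "\<exists>p q. {z. Z2_adj y z \<and> z \<notin> square x} \<subseteq> {p, q}"
  proof -
    obtain x1 x2 where x: "x = (x1, x2)" by fastforce
    consider "y = (x1, x2)" | "y = (x1 + 1, x2)" | "y = (x1, x2 + 1)" | "y = (x1 + 1, x2 + 1)"
      using \<open>y \<in> square x\<close> by (auto simp: square_def x)
    then show ?thesis
    proof cases
      case 1 then have "{z. Z2_adj y z \<and> z \<notin> square x} \<subseteq> {(x1 - 1, x2), (x1, x2 - 1)}"
        by (auto simp: Z2_adj_Pair square_def x)
      then show ?thesis by blast
    next
      case 2 then have "{z. Z2_adj y z \<and> z \<notin> square x} \<subseteq> {(x1 + 2, x2), (x1 + 1, x2 - 1)}"
        by (auto simp: Z2_adj_Pair square_def x)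
      then show ?thesis by blast
    next
      case 3 then have "{z. Z2_adj y z \<and> z \<notin> square x} \<subseteq> {(x1 - 1, x2 + 1), (x1, x2 + 2)}"
        by (auto simp: Z2_adj_Pair square_def x)
      then show ?thesis by blast
    next
      case 4 then have "{z. Z2_adj y z \<and> z \<notin> square x} \<subseteq> {(x1 + 2, x2 + 1), (x1 + 1, x2 + 2)}"
        by (auto simp: Z2_adj_Pair square_def x)
      then show ?thesis by blast
    qed
  qed
  then obtain p q where "{z. Z2_adj y z \<and> z \<notin> square x} \<subseteq> {p, q}" by blast
  then have "card {z. Z2_adj y z \<and> z \<notin> square x} \<le> card {p, q}"
    by (intro card_mono) auto
  also have "\<dots> \<le> 2" by (simp add: card_insert_if)
  finally show "card {z. Z2_adj y z \<and> z \<notin> square x} < \<theta>" using assms(1) by simp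
qed (use assms in auto)

section \<open>Influence from far away travels along geodesics\<close>

definition l1dist :: "int \<times> int \<Rightarrow> int \<times> int \<Rightarrow> int" where
  "l1dist x y = \<bar>fst x - fst y\<bar> + \<bar>snd x - snd y\<bar>"

definition l1ball :: "int \<times> int \<Rightarrow> nat \<Rightarrow> (int \<times> int) set" where
  "l1ball x R = {y. l1dist x y \<le> int R}"

lemma l1dist_self [simp]: "l1dist x x = 0"
  by (simp add: l1dist_def)

lemma l1dist_step: "Z2_adj y z \<Longrightarrow> l1dist x z \<le> l1dist x y + 1"
  by (auto simp: l1dist_def Z2_adj_def)

lemma finite_l1ball [simp]: "finite (l1ball x R)"
proof (rule finite_subset)
  show "l1ball x R \<subseteq> {fst x - int R..fst x + int R} \<times> {snd x - int R..snd x + int R}"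
    by (auto simp: l1ball_def l1dist_def)
qed simp

lemma centre_in_l1ball [simp]: "x \<in> l1ball x R"
  by (simp add: l1ball_def)

text \<open>The two consequences of being a shortest path that keep the number of candidates small: no point is visited
  twice, and points three steps apart are not adjacent, so that U-shaped detours are impossible.\<close>
definition geodesic_like :: "nat \<Rightarrow> (nat \<Rightarrow> int \<times> int) \<Rightarrow> bool" where
  "geodesic_like R z \<longleftrightarrow> (\<forall>i<R. Z2_adj (z i) (z (Suc i))) \<and> inj_on z {..R} \<and>
     (\<forall>i. i + 3 \<le> R \<longrightarrow> \<not> Z2_adj (z i) (z (i + 3)))"

text \<open>A path along which information could enter the ball. Fibres with fewer than \<open>\<theta> - 4\<close> initially occupied
  vertices are inert, and those with more than \<open>\<theta> - 2\<close> fill by themselves or with the help of one occupied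
  vertex in the adjacent fibre of the path.\<close>
definition influence_path ::
  "nat \<Rightarrow> nat \<Rightarrow> (int \<times> int \<Rightarrow> nat) \<Rightarrow> int \<times> int \<Rightarrow> (nat \<Rightarrow> int \<times> int) \<Rightarrow> bool" where
  "influence_path \<theta> R c x z \<longleftrightarrow> z 0 = x \<and> geodesic_like R z \<and>
     (\<forall>i\<le>R. z i \<in> l1ball x R \<and> c (z i) \<in> {\<theta> - 4..\<theta> - 2})"

text \<open>Follow a shortest path inside \<open>D\<close> from \<open>x\<close> to \<open>y\<close>. Its \<open>i\<close>-th point has graph distance exactly \<open>i\<close> from
  \<open>x\<close> within \<open>D\<close>, which rules out repetitions and adjacency of points three steps apart; its length is at
  least the \<open>\<ell>\<^sub>1\<close>-distance of its ends, so that the first \<open>R\<close> steps exist.\<close>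
lemma geodesic_in_connected_set:
  fixes D :: "(int \<times> int) set"
  defines "r \<equiv> {(y, z). y \<in> D \<and> z \<in> D \<and> Z2_adj y z}"
  assumes "(x, y) \<in> r\<^sup>*" "l1dist x y \<ge> int R"
  obtains z where "z 0 = x" "geodesic_like R z" "\<And>i. i < R \<Longrightarrow> (z i, z (Suc i)) \<in> r"
proof -
  have dist: "l1dist x z \<le> int k" if "(x, z) \<in> r ^^ k" for z k
    using that
  proof (induction k arbitrary: z)
    case (Suc k)
    then obtain w where "(x, w) \<in> r ^^ k" "Z2_adj w z" by (auto simp: r_def)
    with Suc.IH[of w] l1dist_step[of w z x] show ?case by simp
  qed simp
  define lev where "lev z = (LEAST k. (x, z) \<in> r ^^ k)" for z
  have lev_le: "lev z \<le> k" if "(x, z) \<in> r ^^ k" for z k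
    unfolding lev_def by (rule Least_le) (rule that)
  define m where "m = lev y"
  have m: "(x, y) \<in> r ^^ m"
    unfolding m_def lev_def using assms(2) by (auto simp: rtrancl_power intro: LeastI)
  then have "R \<le> m" using dist[OF m] assms(3) by simp
  from m obtain z where z: "z 0 = x" "z m = y" "\<And>i. i < m \<Longrightarrow> (z i, z (Suc i)) \<in> r"
    by (auto simp: relpow_fun_conv)
  have from_x: "(x, z i) \<in> r ^^ i" if "i \<le> m" for i
    using that z by (auto simp: relpow_fun_conv intro!: exI[of _ z])
  have to_y: "(z i, y) \<in> r ^^ (m - i)" if "i \<le> m" for i
    using that z by (auto simp: relpow_fun_conv intro!: exI[of _ "\<lambda>j. z (i + j)"])
  have lev_z: "lev (z i) = i" if "i \<le> m" for i
  proof (rule antisym[OF lev_le[OF from_x[OF that]]])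
    have "(x, z i) \<in> r ^^ lev (z i)"
      unfolding lev_def using from_x[OF that] by (rule LeastI)
    then have "(x, y) \<in> r ^^ (lev (z i) + (m - i))"
      using to_y[OF that] by (auto simp: relpow_add)
    from lev_le[OF this] show "i \<le> lev (z i)"
      using that by (simp add: m_def)
  qed
  have lev_step: "lev w \<le> Suc (lev z)" if "(z, w) \<in> r" "(x, z) \<in> r ^^ k" for z w k
  proof -
    have "(x, z) \<in> r ^^ lev z"
      unfolding lev_def using that(2) by (rule LeastI)
    then have "(x, w) \<in> r ^^ Suc (lev z)"
      using that(1) by auto
    then show ?thesis by (rule lev_le)
  qed
  have "geodesic_like R z"
    unfolding geodesic_like_def
  proof (intro conjI allI impI)
    show "Z2_adj (z i) (z (Suc i))" if "i < R" for i
      using z(3)[of i] that \<open>R \<le> m\<close> by (simp add: r_def)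
    show "inj_on z {..R}"
    proof (rule inj_onI)
      fix i j assume ij: "i \<in> {..R}" "j \<in> {..R}" "z i = z j"
      have "i = lev (z i)" "lev (z j) = j"
        using lev_z[of i] lev_z[of j] ij(1,2) \<open>R \<le> m\<close> by auto
      then show "i = j" using ij(3) by (metis (no_types))
    qed
    show "\<not> Z2_adj (z i) (z (i + 3))" if "i + 3 \<le> R" for i
    proof
      assume "Z2_adj (z i) (z (i + 3))"
      moreover have "z i \<in> D" "z (i + 3) \<in> D"
        using z(3)[of i] z(3)[of "i + 2"] that \<open>R \<le> m\<close> by (auto simp: r_def numeral_3_eq_3)
      ultimately have "(z i, z (i + 3)) \<in> r" by (simp add: r_def)
      from lev_step[OF this from_x[of i]] lev_z[of i] lev_z[of "i + 3"] that \<open>R \<le> m\<close>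
      show False by simp
    qed
  qed
  with z \<open>R \<le> m\<close> show thesis by (intro that[of z]) auto
qed

text \<open>Let \<open>D\<close> be the set of points of the ball above which the global and the local final configurations differ. If the
  connected component \<open>C\<close> of the centre in \<open>D\<close> had all its neighbours in the ball, then the configuration that
  is local above \<open>C\<close> and global elsewhere would be closed, hence would contain the global one, which is absurd.
  So \<open>C\<close> comes close to the boundary and contains a long geodesic. The disjointness of the initial fibres is what
  lets a single occupied vertex next door complete a fibre with \<open>\<theta> - 1\<close> occupied vertices.\<close>
lemma far_influence_needs_path:
  assumes \<theta>: "\<theta> \<ge> 5" and R: "R \<ge> 1" and "u < n"
    and disj: "\<And>y z. y \<in> l1ball x R \<Longrightarrow> z \<in> l1ball x R \<Longrightarrow> y \<noteq> z \<Longrightarrow>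
                 fibre n \<omega> y \<inter> fibre n \<omega> z = {}"
    and global: "(x, u) \<in> occupied n \<theta> \<omega>"
    and local: "(x, u) \<notin> occupied n \<theta> (\<omega> \<inter> l1ball x R \<times> UNIV)"
  obtains z where "influence_path \<theta> R (\<lambda>y. card (fibre n \<omega> y)) x z"
proof -
  define B where "B = l1ball x R"
  define \<omega>' where "\<omega>' = \<omega> \<inter> B \<times> UNIV"
  define G where "G = occupied n \<theta> \<omega>"
  define L where "L = occupied n \<theta> \<omega>'"
  have init: "\<omega>' \<subseteq> L" unfolding L_def by (rule initial_subset_limit)
  have fib: "fibre n \<omega>' y = fibre n \<omega> y" if "y \<in> B" for y
    using that by (auto simp: fibre_def \<omega>'_def)
  define D where "D = {y \<in> B. \<exists>v<n. (y, v) \<in> G \<and> (y, v) \<notin> L}"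
  define r where "r = {(y, z). y \<in> D \<and> z \<in> D \<and> Z2_adj y z}"
  have "x \<in> D"
    using assms(3) global local by (auto simp: D_def B_def G_def L_def \<omega>'_def)
  have D_card: "\<theta> - 4 \<le> card (fibre n \<omega> y)" "card (fibre n \<omega> y) < \<theta>" if y: "y \<in> D" for y
  proof -
    from y obtain v where v: "y \<in> B" "v < n" "(y, v) \<in> G" "(y, v) \<notin> L"
      by (auto simp: D_def)
    show "card (fibre n \<omega> y) < \<theta>"
      using fibre_initially_full[of \<theta> n \<omega>' y v] v fib[OF v(1)] by (auto simp: L_def not_le[symmetric])
    show "\<theta> - 4 \<le> card (fibre n \<omega> y)"
    proof (rule ccontr)
      assume "\<not> ?thesis"
      then have "(y, v) \<in> \<omega>"
        using fibre_inert[of n \<omega> y \<theta> v] v by (simp add: G_def)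
      then have "(y, v) \<in> \<omega>'" using v by (simp add: \<omega>'_def)
      then show False using init v by blast
    qed
  qed
  \<comment> \<open>A fibre one short of the threshold and next to another fibre of \<open>D\<close> fills already in the local process.\<close>
  have D_edge: "card (fibre n \<omega> y) \<le> \<theta> - 2" if yz: "y \<in> D" "z \<in> D" "Z2_adj y z" for y z
  proof (rule ccontr)
    assume "\<not> ?thesis"
    then have card_y: "card (fibre n \<omega> y) = \<theta> - 1" using D_card[OF yz(1)] by simp
    have yzB: "y \<in> B" "z \<in> B" "y \<noteq> z" using yz by (auto simp: D_def)
    have "fibre n \<omega> z \<noteq> {}" using D_card[OF yz(2)] \<theta> by auto
    then obtain v where v: "v \<in> fibre n \<omega> z" by blast
    then have v': "v \<notin> fibre n \<omega> y" "v < n" "(z, v) \<in> \<omega>'"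
      using disj[of y z] yzB by (auto simp: B_def fibre_def \<omega>'_def)
    have sub: "fibre n \<omega> y \<subseteq> fibre n L y"
      unfolding fib[OF yzB(1), symmetric] using init by (auto simp: fibre_def)
    have "(y, v) \<in> L"
    proof (cases "v \<in> fibre n L y")
      case False
      have "\<theta> - 1 \<le> card (fibre n L y - {v})"
        using card_mono[OF finite_fibre sub] card_y False by simp
      moreover have "1 \<le> card {w. Z2_adj y w \<and> (w, v) \<in> L}"
      proof -
        have "card {z} \<le> card {w. Z2_adj y w \<and> (w, v) \<in> L}"
          using yz(3) v'(3) init by (intro card_mono) auto
        then show ?thesis by simp
      qed
      ultimately show ?thesis
        unfolding L_def by (intro occupied_closed[OF v'(2)]) (use \<theta> in linarith)
    qed (simp add: fibre_def)
    then have "insert v (fibre n \<omega> y) \<subseteq> fibre n L y"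
      using sub v'(2) by (auto simp: fibre_def)
    from card_mono[OF finite_fibre this] have "\<theta> \<le> card (fibre n L y)"
      using v'(1) card_y \<theta> by simp
    then have "(y, w) \<in> L" if "w < n" for w
      using fibre_full that unfolding L_def by blast
    then show False using yz(1) by (auto simp: D_def)
  qed
  have "\<exists>y. (x, y) \<in> r\<^sup>* \<and> l1dist x y \<ge> int R"
  proof (rule ccontr)
    assume neg: "\<not> ?thesis"
    define C where "C = {y. (x, y) \<in> r\<^sup>*}"
    \<comment> \<open>\<open>W\<close> is local above the component \<open>C\<close> and global elsewhere.\<close>
    define W where "W = {w \<in> G. fst w \<in> C \<longrightarrow> w \<in> L}"
    have CD: "C \<subseteq> D"
      using \<open>x \<in> D\<close> by (auto simp: C_def r_def elim: rtranclE)
    have CB: "C \<subseteq> B" using CD by (auto simp: D_def)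
    have inside: "z \<in> B" if "y \<in> C" "Z2_adj y z" for y z
    proof -
      have "l1dist x y < int R" using neg that(1) unfolding C_def mem_Collect_eq by (meson not_le)
      then show ?thesis using l1dist_step[OF that(2), of x] by (simp add: B_def l1ball_def)
    qed
    \<comment> \<open>Next to \<open>C\<close>, but outside \<open>C\<close>, the two configurations agree.\<close>
    have agree: "(z, v) \<in> L" if "y \<in> C" "Z2_adj y z" "(z, v) \<in> W" "v < n" for y z v
    proof (cases "z \<in> C")
      case False
      have "z \<notin> D"
      proof
        assume "z \<in> D"
        then have "(y, z) \<in> r" using that CD by (auto simp: r_def)
        then show False using False that(1) by (auto simp: C_def intro: rtrancl_into_rtrancl)
      qed
      then show ?thesis using inside[OF that(1,2)] that by (auto simp: D_def W_def)
    qed (use that in \<open>auto simp: W_def\<close>)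
    have "G \<subseteq> W"
      unfolding G_def
    proof (rule occupied_least)
      show "\<omega> \<subseteq> W"
      proof
        fix w assume "w \<in> \<omega>"
        moreover have "w \<in> L" if "fst w \<in> C"
          using CB that \<open>w \<in> \<omega>\<close> by (intro subsetD[OF init]) (auto simp: \<omega>'_def mem_Times_iff)
        ultimately show "w \<in> W"
          using initial_subset_limit[of \<omega>] by (auto simp: W_def G_def)
      qed
      fix y v
      assume v: "v < n" "\<theta> \<le> card (fibre n W y - {v}) + card {z. Z2_adj y z \<and> (z, v) \<in> W}"
      have "(y, v) \<in> G"
        unfolding G_def
      proof (rule occupied_closed[OF v(1)], rule order_trans[OF v(2)], rule add_mono)
        show "card (fibre n W y - {v}) \<le> card (fibre n (occupied n \<theta> \<omega>) y - {v})"
          by (intro card_mono) (auto simp: fibre_def W_def G_def)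
        show "card {z. Z2_adj y z \<and> (z, v) \<in> W} \<le> card {z. Z2_adj y z \<and> (z, v) \<in> occupied n \<theta> \<omega>}"
          by (intro card_mono) (auto simp: W_def G_def)
      qed
      moreover have "(y, v) \<in> L" if "y \<in> C"
        unfolding L_def
      proof (rule occupied_closed[OF v(1)], rule order_trans[OF v(2)], rule add_mono)
        show "card (fibre n W y - {v}) \<le> card (fibre n (occupied n \<theta> \<omega>') y - {v})"
          using that by (intro card_mono) (auto simp: fibre_def W_def L_def)
        show "card {z. Z2_adj y z \<and> (z, v) \<in> W} \<le> card {z. Z2_adj y z \<and> (z, v) \<in> occupied n \<theta> \<omega>'}"
          using agree[OF that _ _ v(1)] by (intro card_mono) (auto simp: L_def)
      qed
      ultimately show "(y, v) \<in> W" by (simp add: W_def)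
    qed
    then have "(x, u) \<in> L"
      using global by (auto simp: W_def C_def G_def)
    then show False using local by (simp add: L_def \<omega>'_def B_def)
  qed
  then obtain y where "(x, y) \<in> r\<^sup>*" "l1dist x y \<ge> int R" by blast
  then obtain z where z: "z 0 = x" "geodesic_like R z" "\<And>i. i < R \<Longrightarrow> (z i, z (Suc i)) \<in> r"
    unfolding r_def by (rule geodesic_in_connected_set) (auto simp: r_def)
  have r_iff: "(y, w) \<in> r \<longleftrightarrow> y \<in> D \<and> w \<in> D \<and> Z2_adj y w" for y w
    by (simp add: r_def)
  have "z i \<in> l1ball x R \<and> card (fibre n \<omega> (z i)) \<in> {\<theta> - 4..\<theta> - 2}" if "i \<le> R" for i
  proof -
    have "\<exists>w. z i \<in> D \<and> w \<in> D \<and> Z2_adj (z i) w"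
    proof (cases "i < R")
      case True
      then show ?thesis using z(3)[of i] unfolding r_iff by blast
    next
      case False
      then have "Suc (i - 1) = i" "i - 1 < R" using R that by auto
      with z(3)[of "i - 1"] show ?thesis unfolding r_iff by (metis Z2_adj_sym)
    qed
    then obtain w where "z i \<in> D" "w \<in> D" "Z2_adj (z i) w" by blast
    with D_edge D_card show ?thesis by (auto simp: D_def B_def)
  qed
  with z show thesis
    by (intro that[of z]) (simp add: influence_path_def)
qed

section \<open>Counting geodesic paths\<close>

text \<open>
  Paths are coded as lists of points, the latest point first. After a straight step three continuations are
  possible: straight on or a turn to either side. After a turn only two are: straight on, or back to the
  direction before the turn, since repeating the turn would create a U-shape. The last continuation is \<open>zigzag\<close>.
\<close>
definition straight :: "(int \<times> int) list \<Rightarrow> (int \<times> int) list" where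
  "straight p = (p ! 0 + (p ! 0 - p ! 1)) # p"

definition quarter_turn :: "int \<times> int \<Rightarrow> int \<times> int" where
  "quarter_turn d = (- snd d, fst d)"

definition turn_left :: "(int \<times> int) list \<Rightarrow> (int \<times> int) list" where
  "turn_left p = (p ! 0 + quarter_turn (p ! 0 - p ! 1)) # p"

definition turn_right :: "(int \<times> int) list \<Rightarrow> (int \<times> int) list" where
  "turn_right p = (p ! 0 - quarter_turn (p ! 0 - p ! 1)) # p"

definition zigzag :: "(int \<times> int) list \<Rightarrow> (int \<times> int) list" where
  "zigzag p = (p ! 0 + (p ! 1 - p ! 2)) # p"

text \<open>The sets are only upper bounds for the paths whose last step is straight or turned. The first step counts as
  straight, because all three continuations are open to it.\<close>
fun straight_paths turned_paths :: "int \<times> int \<Rightarrow> nat \<Rightarrow> (int \<times> int) list set" where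
  "straight_paths x 0 = (\<lambda>d. [x + d, x]) ` {(1,0), (-1,0), (0,1), (0,-1)}"
| "turned_paths x 0 = {}"
| "straight_paths x (Suc k) = straight ` (straight_paths x k \<union> turned_paths x k)"
| "turned_paths x (Suc k) = turn_left ` straight_paths x k \<union> turn_right ` straight_paths x k \<union>
     zigzag ` turned_paths x k"

lemma finite_paths: "finite (straight_paths x k)" "finite (turned_paths x k)"
  by (induction k) auto

text \<open>With \<open>s\<close> straight and \<open>t\<close> turned paths, the next step gives \<open>s + t\<close> and \<open>2 s + t\<close>. The growth rate of this
  recursion is \<open>1 + \<surd>2 < 5/2\<close>, and the weights \<open>4\<close> and \<open>3\<close> turn it into a one-line contraction:
  \<open>4 (s + t) + 3 (2 s + t) = 10 s + 7 t \<le> 5/2 \<cdot> (4 s + 3 t)\<close>.\<close>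
lemma weighted_path_count:
  "4 * real (card (straight_paths x k)) + 3 * real (card (turned_paths x k)) \<le> 16 * (5/2) ^ k"
proof (induction k)
  case 0
  have "card ((\<lambda>d. [x + d, x]) ` {(1,0), (-1,0), (0,1), (0,-1)}) \<le>
      card {(1,0), (-1,0), (0,1), (0,-1) :: int \<times> int}"
    by (rule card_image_le) simp
  then show ?case by (simp add: card_insert_if)
next
  case (Suc k)
  let ?S = "straight_paths x k" and ?T = "turned_paths x k"
  have "card (straight_paths x (Suc k)) \<le> card ?S + card ?T"
  proof -
    have "card (straight ` (?S \<union> ?T)) \<le> card (?S \<union> ?T)"
      by (rule card_image_le) (simp add: finite_paths)
    also have "\<dots> \<le> card ?S + card ?T" by (rule card_Un_le)
    finally show ?thesis by simp
  qed
  moreover have "card (turned_paths x (Suc k)) \<le> 2 * card ?S + card ?T"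
  proof -
    have "card (turned_paths x (Suc k)) \<le>
        card (turn_left ` ?S \<union> turn_right ` ?S) + card (zigzag ` ?T)"
      by (simp add: card_Un_le)
    moreover have "card (turn_left ` ?S \<union> turn_right ` ?S) \<le> card (turn_left ` ?S) + card (turn_right ` ?S)"
      by (rule card_Un_le)
    moreover have "card (turn_left ` ?S) \<le> card ?S" "card (turn_right ` ?S) \<le> card ?S"
        "card (zigzag ` ?T) \<le> card ?T"
      by (simp_all add: card_image_le finite_paths)
    ultimately show ?thesis by linarith
  qed
  ultimately have "4 * real (card (straight_paths x (Suc k))) + 3 * real (card (turned_paths x (Suc k))) \<le>
      4 * (real (card ?S) + real (card ?T)) + 3 * (2 * real (card ?S) + real (card ?T))"
    by (intro add_mono mult_left_mono) linarith+
  also have "\<dots> \<le> 5/2 * (4 * real (card ?S) + 3 * real (card ?T))" by simp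
  also have "\<dots> \<le> 5/2 * (16 * (5/2) ^ k)" using Suc by (intro mult_left_mono) auto
  finally show ?case by simp
qed

definition path_codes :: "int \<times> int \<Rightarrow> nat \<Rightarrow> (int \<times> int) list set" where
  "path_codes x R = straight_paths x (R - 1) \<union> turned_paths x (R - 1)"

lemma finite_path_codes: "finite (path_codes x R)"
  by (simp add: path_codes_def finite_paths)

lemma card_path_codes:
  assumes "R \<ge> 1"
  shows "real (card (path_codes x R)) \<le> 6 * (5/2) ^ R"
proof -
  have "real (card (path_codes x R)) \<le>
      real (card (straight_paths x (R - 1))) + real (card (turned_paths x (R - 1)))"
    unfolding path_codes_def using card_Un_le[of "straight_paths x (R - 1)" "turned_paths x (R - 1)"]
    by linarith
  also have "\<dots> \<le> 6 * (5/2) ^ (R - 1)"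
  proof -
    have "0 \<le> (5/2 :: real) ^ (R - 1)" by simp
    then show ?thesis
      using weighted_path_count[of x "R - 1"] by linarith
  qed
  also have "\<dots> \<le> 6 * (5/2) ^ R"
    by (intro mult_left_mono power_increasing) auto
  finally show ?thesis .
qed

lemma unit_step_cases:
  assumes "e \<in> {(1,0), (-1,0), (0,1), (0,-1)}" "f \<in> {(1,0), (-1,0), (0,1), (0,-1)}" "f \<noteq> - e"
  shows "f = e \<or> f = quarter_turn e \<or> f = - quarter_turn e"
  using assms by (auto simp: quarter_turn_def)

text \<open>With \<open>d\<close> and \<open>e\<close> perpendicular, \<open>f = - d\<close> would end next to the starting point: \<open>d + e + f = e\<close>.\<close>
lemma unit_step_cases_after_turn:
  fixes d e f :: "int \<times> int"
  assumes "d \<in> {(1,0), (-1,0), (0,1), (0,-1)}" "e \<in> {(1,0), (-1,0), (0,1), (0,-1)}"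
    "f \<in> {(1,0), (-1,0), (0,1), (0,-1)}" "e \<noteq> - d" "e \<noteq> d" "f \<noteq> - e"
    "d + e + f \<notin> {(1,0), (-1,0), (0,1), (0,-1)}"
  shows "f = e \<or> f = d"
proof -
  have e: "e = quarter_turn d \<or> e = - quarter_turn d"
    using unit_step_cases[OF assms(1,2,4)] assms(5) by simp
  have "f = quarter_turn e \<or> f = e \<or> f = - quarter_turn e"
    using unit_step_cases[OF assms(2,3,6)] by blast
  moreover have "quarter_turn (quarter_turn d) = - d" "quarter_turn (- quarter_turn d) = d"
    by (cases d; simp add: quarter_turn_def)+
  ultimately have "f = e \<or> f = d \<or> f = - d"
    using e by auto
  moreover have "f \<noteq> - d"
    using assms(2,7) by auto
  ultimately show ?thesis by blast
qed

text \<open>The invariant keeps the last two steps different in the turned case, since \<open>zigzag\<close> refers to the direction before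
  the turn. Codes start with a path of one step, which accounts for the shift between \<open>k\<close> and the length.\<close>
lemma geodesic_like_coded:
  assumes "geodesic_like R z" "z 0 = x" "Suc k \<le> R"
  defines "code \<equiv> \<lambda>k. rev (map z [0..<Suc (Suc k)])"
  shows "code k \<in> straight_paths x k \<or>
    (k \<ge> 1 \<and> code k \<in> turned_paths x k \<and> z (Suc k) - z k \<noteq> z k - z (k - 1))"
  using assms(3)
proof (induction k)
  case 0
  have "z 1 - x \<in> {(1,0), (-1,0), (0,1), (0,-1)}"
    using assms(1,2) 0 by (auto simp: geodesic_like_def Z2_adj_iff)
  then have "[x + (z 1 - x), x] \<in> straight_paths x 0"
    unfolding straight_paths.simps by (rule imageI)
  then show ?case by (simp add: code_def assms(2))
next
  case (Suc k)
  let ?U = "{(1,0), (-1,0), (0,1), (0,-1)} :: (int \<times> int) set"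
  define e where "e = z (Suc k) - z k"
  define f where "f = z (Suc (Suc k)) - z (Suc k)"
  have e: "e \<in> ?U" and f: "f \<in> ?U"
    using assms(1) Suc.prems unfolding geodesic_like_def Z2_adj_iff e_def f_def by auto
  have "z (Suc (Suc k)) \<noteq> z k"
    using assms(1) Suc.prems unfolding geodesic_like_def by (auto dest!: inj_onD)
  then have fe: "f \<noteq> - e" by (auto simp: e_def f_def)
  have codeSuc: "code (Suc k) = (z (Suc k) + f) # code k"
    by (simp add: code_def f_def)
  have nth: "code k ! 0 = z (Suc k)" "code k ! Suc 0 = z k"
    by (simp_all add: code_def)
  have S: "straight (code k) = (z (Suc k) + e) # code k"
    "turn_left (code k) = (z (Suc k) + quarter_turn e) # code k"
    "turn_right (code k) = (z (Suc k) - quarter_turn e) # code k"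
    by (simp_all add: straight_def turn_left_def turn_right_def nth e_def)
  have IH: "code k \<in> straight_paths x k \<or> (k \<ge> 1 \<and> code k \<in> turned_paths x k \<and> e \<noteq> z k - z (k - 1))"
    using Suc by (simp add: e_def)
  show ?case
  proof (cases "f = e")
    case True
    then have "code (Suc k) = straight (code k)" by (simp add: codeSuc S)
    then show ?thesis using IH by auto
  next
    case False
    then have diff: "z (Suc (Suc k)) - z (Suc k) \<noteq> z (Suc k) - z (Suc k - 1)"
      by (simp add: e_def f_def)
    have "code (Suc k) \<in> turned_paths x (Suc k)"
      using IH
    proof
      assume "code k \<in> straight_paths x k"
      moreover have "f = quarter_turn e \<or> f = - quarter_turn e"
        using unit_step_cases[OF e f fe] False by simp
      then have "code (Suc k) = turn_left (code k) \<or> code (Suc k) = turn_right (code k)"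
        by (auto simp: codeSuc S)
      ultimately show ?thesis by auto
    next
      define d where "d = z k - z (k - 1)"
      assume IH': "k \<ge> 1 \<and> code k \<in> turned_paths x k \<and> e \<noteq> z k - z (k - 1)"
      then obtain j where j: "k = Suc j" by (cases k) auto
      have d: "d \<in> ?U"
        using assms(1) Suc.prems unfolding geodesic_like_def Z2_adj_iff d_def j by auto
      have "z (Suc (Suc j)) \<noteq> z j"
        using assms(1) Suc.prems unfolding geodesic_like_def j by (auto dest!: inj_onD)
      then have ed: "e \<noteq> - d" by (auto simp: e_def d_def j)
      have "\<not> Z2_adj (z j) (z (j + 3))"
        using assms(1) Suc.prems unfolding geodesic_like_def j by auto
      moreover have "z (j + 3) - z j = d + e + f"
        by (simp add: d_def e_def f_def j numeral_3_eq_3)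
      ultimately have "d + e + f \<notin> ?U" unfolding Z2_adj_iff by simp
      then have "f = d"
        using unit_step_cases_after_turn[OF d e f ed _ fe] False IH' by (auto simp: d_def)
      moreover have "code k ! 2 = z (k - 1)"
        by (simp add: code_def j numeral_2_eq_2)
      ultimately have "code (Suc k) = zigzag (code k)"
        by (simp add: codeSuc zigzag_def nth d_def)
      then show ?thesis using IH' by auto
    qed
    then show ?thesis using diff by simp
  qed
qed

text \<open>The conditions on a code that allow the counts on it to be treated as independent: its points are distinct and
  lie in the ball.\<close>
definition passable_code ::
  "nat \<Rightarrow> nat \<Rightarrow> (int \<times> int \<Rightarrow> nat) \<Rightarrow> int \<times> int \<Rightarrow> (int \<times> int) list \<Rightarrow> bool" where
  "passable_code \<theta> R c x p \<longleftrightarrow> distinct p \<and> length p = Suc R \<and> set p \<subseteq> l1ball x R \<and>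
     (\<forall>y\<in>set p. c y \<in> {\<theta> - 4..\<theta> - 2})"

lemma influence_path_coded:
  assumes "influence_path \<theta> R c x z" "R \<ge> 1"
  shows "\<exists>p\<in>path_codes x R. passable_code \<theta> R c x p"
proof -
  obtain k where k: "R = Suc k" using assms(2) by (cases R) auto
  let ?p = "rev (map z [0..<Suc (Suc k)])"
  have z: "geodesic_like R z" "z 0 = x" "\<And>i. i \<le> R \<Longrightarrow> z i \<in> l1ball x R \<and> c (z i) \<in> {\<theta> - 4..\<theta> - 2}"
    using assms by (auto simp: influence_path_def)
  have "?p \<in> path_codes x R"
    using geodesic_like_coded[OF z(1,2), of k] by (auto simp: path_codes_def k)
  have "inj_on z {0..<Suc (Suc k)}"
    using z(1) by (auto simp: geodesic_like_def k atLeast0LessThan lessThan_Suc_atMost)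
  then have "distinct ?p" by (simp only: distinct_rev distinct_map distinct_upt set_upt simp_thms)
  moreover have "set ?p \<subseteq> z ` {..R}"
    by (auto simp: k)
  ultimately have "passable_code \<theta> R c x ?p"
    using z(3) unfolding passable_code_def by (auto simp: k simp del: upt_Suc)
  with \<open>?p \<in> path_codes x R\<close> show ?thesis by blast
qed

section \<open>The local outcome depends only on the counts\<close>

text \<open>Two \<open>K\<^sub>n\<close>-coordinates with the same pattern are exchanged by a symmetry of the initial configuration.\<close>
definition pattern :: "vertex set \<Rightarrow> nat \<Rightarrow> (int \<times> int) set" where
  "pattern \<omega> u = {x. (x, u) \<in> \<omega>}"

lemma mem_bootstrap_Suc:
  assumes "u < n"
  shows "(x, u) \<in> bootstrap (vertices n) (adj n) \<theta> \<omega> (Suc t) \<longleftrightarrow>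
    (x, u) \<in> bootstrap (vertices n) (adj n) \<theta> \<omega> t \<or>
    \<theta> \<le> card (fibre n (bootstrap (vertices n) (adj n) \<theta> \<omega> t) x - {u}) +
      card {y. Z2_adj x y \<and> (y, u) \<in> bootstrap (vertices n) (adj n) \<theta> \<omega> t}"
  using assms card_neighbours[OF assms] by (simp add: vertices_def)

text \<open>Coordinates with equal patterns behave alike at all times, even across different \<open>n\<close>. The only classes whose
  sizes differ are those of the empty pattern; once such a class is occupied in a fibre, it alone supplies \<open>\<theta>\<close> vertices in
  both systems, and until then it contributes nothing to the size of that fibre.\<close>
lemma same_patterns_same_bootstrap:
  assumes \<theta>: "\<theta> > 0"
    and classes: "\<And>S. S \<noteq> {} \<Longrightarrow> card {u. u < n \<and> pattern \<omega> u = S} = card {u. u < n' \<and> pattern \<omega>' u = S}"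
    and generic: "\<theta> \<le> card {u. u < n \<and> pattern \<omega> u = {}}" "\<theta> \<le> card {u. u < n' \<and> pattern \<omega>' u = {}}"
    and "u < n" "u' < n'" "pattern \<omega> u = pattern \<omega>' u'"
  shows "(x, u) \<in> bootstrap (vertices n) (adj n) \<theta> \<omega> t \<longleftrightarrow>
    (x, u') \<in> bootstrap (vertices n') (adj n') \<theta> \<omega>' t"
  using assms(5-7)
proof (induction t arbitrary: x u u')
  case 0
  then show ?case by (auto simp: pattern_def)
next
  case (Suc t)
  define b where "b = bootstrap (vertices n) (adj n) \<theta> \<omega> t"
  define b' where "b' = bootstrap (vertices n') (adj n') \<theta> \<omega>' t"
  have IH: "(x, v) \<in> b \<longleftrightarrow> (x, v') \<in> b'" if "v < n" "v' < n'" "pattern \<omega> v = pattern \<omega>' v'" for x v v'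
    unfolding b_def b'_def using Suc.IH[OF that] .
  show ?case
  proof (cases "(x, u) \<in> b")
    case True
    then show ?thesis using IH[OF Suc.prems] by (simp add: b_def b'_def)
  next
    case False
    with IH[OF Suc.prems] have False': "(x, u') \<notin> b'" by simp
    have diff: "fibre n b x - {u} = fibre n b x" "fibre n' b' x - {u'} = fibre n' b' x"
      using False False' by (auto simp: fibre_def)
    have nbrs: "{y. Z2_adj x y \<and> (y, u) \<in> b} = {y. Z2_adj x y \<and> (y, u') \<in> b'}"
      using IH[OF Suc.prems] by simp
    define H where "H = {g. g < n \<and> pattern \<omega> g = {}}"
    define H' where "H' = {g. g < n' \<and> pattern \<omega>' g = {}}"
    \<comment> \<open>Coordinates with empty pattern behave alike, so one representative \<open>g\<close> decides for all of them.\<close>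
    have "H \<noteq> {}" using generic(1) \<theta> by (auto simp: H_def[symmetric])
    then obtain g where g: "g < n" "pattern \<omega> g = {}" by (auto simp: H_def)
    have "\<theta> \<le> card (fibre n b x) + m \<longleftrightarrow> \<theta> \<le> card (fibre n' b' x) + m" for m
    proof (cases "(x, g) \<in> b")
      case True
      have H': "(x, h) \<in> b'" if "h \<in> H'" for h
        using IH[of g h x] g that True by (simp add: H'_def)
      have "H' \<noteq> {}" using generic(2) \<theta> by (auto simp: H'_def[symmetric])
      then obtain g' where g': "g' \<in> H'" by blast
      have "(x, h) \<in> b" if "h \<in> H" for h
        using IH[of h g' x] H'[OF g'] g' that by (simp add: H_def H'_def)
      then have "H \<subseteq> fibre n b x" by (auto simp: H_def fibre_def)
      moreover have "H' \<subseteq> fibre n' b' x" using H' by (auto simp: H'_def fibre_def)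
      ultimately have "\<theta> \<le> card (fibre n b x)" "\<theta> \<le> card (fibre n' b' x)"
        using generic[folded H_def H'_def] card_mono[OF finite_fibre] le_trans by blast+
      then show ?thesis by simp
    next
      case gb: False
      \<comment> \<open>No coordinate with empty pattern is occupied here, and the remaining classes have equal sizes in both systems.\<close>
      define K where "K = (pattern \<omega> ` {..<n} \<union> pattern \<omega>' ` {..<n'}) - {{}}"
      have finK: "finite K" by (simp add: K_def)
      have no: "(x, h) \<notin> b'" if "h < n'" "pattern \<omega>' h = {}" for h
        using IH[of g h x] g that gb by simp
      then obtain g' where g': "g' < n'" "pattern \<omega>' g' = {}" "(x, g') \<notin> b'"
        using generic(2) \<theta> by (cases "H' = {}") (auto simp: H'_def[symmetric], auto simp: H'_def)
      have no': "(x, h) \<notin> b" if "h < n" "pattern \<omega> h = {}" for h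
        using IH[of h g' x] g' that by simp
      have "fibre n b x = (\<Union>S\<in>K. {v. v < n \<and> pattern \<omega> v = S \<and> (x, v) \<in> b})"
        using no' by (auto simp: fibre_def K_def)
      then have c: "card (fibre n b x) = (\<Sum>S\<in>K. card {v. v < n \<and> pattern \<omega> v = S \<and> (x, v) \<in> b})"
        using finK by (simp, subst card_UN_disjoint) auto
      have "fibre n' b' x = (\<Union>S\<in>K. {v. v < n' \<and> pattern \<omega>' v = S \<and> (x, v) \<in> b'})"
        using no by (auto simp: fibre_def K_def)
      then have c': "card (fibre n' b' x) = (\<Sum>S\<in>K. card {v. v < n' \<and> pattern \<omega>' v = S \<and> (x, v) \<in> b'})"
        using finK by (simp, subst card_UN_disjoint) auto
      have "card {v. v < n \<and> pattern \<omega> v = S \<and> (x, v) \<in> b} =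
          card {v. v < n' \<and> pattern \<omega>' v = S \<and> (x, v) \<in> b'}" if "S \<in> K" for S
      proof -
        define A where "A = {v. v < n \<and> pattern \<omega> v = S}"
        define A' where "A' = {v. v < n' \<and> pattern \<omega>' v = S}"
        have fin: "finite A" "finite A'" by (auto simp: A_def A'_def)
        have eq: "card A = card A'" using classes[of S] that by (auto simp: K_def A_def A'_def)
        show ?thesis
        proof (cases "A = {}")
          case True
          then have "A' = {}" using eq fin by auto
          have "{v. v < n \<and> pattern \<omega> v = S \<and> (x, v) \<in> b} = {}"
            "{v. v < n' \<and> pattern \<omega>' v = S \<and> (x, v) \<in> b'} = {}"
            using True \<open>A' = {}\<close> by (auto simp: A_def A'_def)
          then show ?thesis by (simp only: card.empty)
        next
          case False
          then have "A' \<noteq> {}" using eq fin by auto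
          then obtain a a' where a: "a \<in> A" "a' \<in> A'" using False by blast
          have in1: "(x, v) \<in> b \<longleftrightarrow> (x, a') \<in> b'" if "v \<in> A" for v
            using IH[of v a' x] that a by (simp add: A_def A'_def)
          have in2: "(x, v) \<in> b' \<longleftrightarrow> (x, a) \<in> b" if "v \<in> A'" for v
            using IH[of a v x] that a by (simp add: A_def A'_def)
          have "{v. v < n \<and> pattern \<omega> v = S \<and> (x, v) \<in> b} = (if (x, a) \<in> b then A else {})"
            using in1 a by (auto simp: A_def)
          moreover have "{v. v < n' \<and> pattern \<omega>' v = S \<and> (x, v) \<in> b'} = (if (x, a) \<in> b then A' else {})"
            using in2 by (auto simp: A'_def)
          ultimately show ?thesis
            using eq by (cases "(x, a) \<in> b") (simp_all only: if_True if_False card.empty)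
        qed
      qed
      then have "card (fibre n b x) = card (fibre n' b' x)"
        unfolding c c' by (intro sum.cong) auto
      then show ?thesis by simp
    qed
    then show ?thesis
      using Suc.prems False False' diff nbrs unfolding b_def b'_def
      by (simp only: mem_bootstrap_Suc simp_thms)
  qed
qed

text \<open>The typical situation for large \<open>n\<close>: over \<open>B\<close> every pattern is empty or a singleton, and the pattern at the
  coordinate \<open>u\<close> of the vertex under observation is empty. The counts then determine the sizes of all classes.\<close>
definition isolated_counts ::
  "nat \<Rightarrow> (int \<times> int) set \<Rightarrow> nat \<Rightarrow> (int \<times> int \<Rightarrow> nat) \<Rightarrow> vertex set \<Rightarrow> bool" where
  "isolated_counts n B u c \<omega> \<longleftrightarrow> (\<forall>y\<in>B. card (fibre n \<omega> y) = c y) \<and>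
     (\<forall>y\<in>B. \<forall>z\<in>B. y \<noteq> z \<longrightarrow> fibre n \<omega> y \<inter> fibre n \<omega> z = {}) \<and> (\<forall>y\<in>B. u \<notin> fibre n \<omega> y)"

lemma isolated_counts_classes:
  assumes iso: "isolated_counts n B u c \<omega>" and "finite B" "u < n"
  defines "\<sigma> \<equiv> \<omega> \<inter> B \<times> UNIV"
  shows "S \<noteq> {} \<Longrightarrow> card {v. v < n \<and> pattern \<sigma> v = S} = (if \<exists>y\<in>B. S = {y} then c (THE y. S = {y}) else 0)"
    and "n - sum c B \<le> card {v. v < n \<and> pattern \<sigma> v = {}}"
    and "pattern \<sigma> u = {}"
proof -
  have pat: "y \<in> pattern \<sigma> v \<longleftrightarrow> y \<in> B \<and> v \<in> fibre n \<omega> y" if "v < n" for y v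
    using that by (auto simp: pattern_def \<sigma>_def fibre_def)
  have disj: "y = z" if "v < n" "y \<in> pattern \<sigma> v" "z \<in> pattern \<sigma> v" for y z v
    using iso that pat[OF that(1)] unfolding isolated_counts_def by blast
  show "card {v. v < n \<and> pattern \<sigma> v = S} = (if \<exists>y\<in>B. S = {y} then c (THE y. S = {y}) else 0)"
    if "S \<noteq> {}"
  proof (cases "\<exists>y\<in>B. S = {y}")
    case True
    then obtain y where y: "y \<in> B" "S = {y}" by blast
    have "pattern \<sigma> v = S \<longleftrightarrow> v \<in> fibre n \<omega> y" if "v < n" for v
      using disj[OF that] pat[OF that] y by blast
    then have "{v. v < n \<and> pattern \<sigma> v = S} = fibre n \<omega> y"
      by (auto simp: fibre_def)
    then show ?thesis using iso y by (auto simp: isolated_counts_def)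
  next
    case False
    have "pattern \<sigma> v \<noteq> S" if "v < n" for v
    proof
      assume S: "pattern \<sigma> v = S"
      with \<open>S \<noteq> {}\<close> obtain y where "y \<in> S" by blast
      with S disj[OF that] pat[OF that] have "S = {y}" "y \<in> B" by blast+
      then show False using False by blast
    qed
    then have "{v. v < n \<and> pattern \<sigma> v = S} = {}" by blast
    then show ?thesis using False by (simp only: card.empty if_False)
  qed
  have "{v. v < n \<and> pattern \<sigma> v = {}} = {..<n} - (\<Union>y\<in>B. fibre n \<omega> y)"
    using pat by (auto simp: fibre_def)
  moreover have "card (\<Union>y\<in>B. fibre n \<omega> y) \<le> sum c B"
  proof -
    have "card (\<Union>y\<in>B. fibre n \<omega> y) \<le> (\<Sum>y\<in>B. card (fibre n \<omega> y))"
      by (rule card_UN_le[OF \<open>finite B\<close>])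
    also have "\<dots> = sum c B" using iso by (intro sum.cong) (auto simp: isolated_counts_def)
    finally show ?thesis .
  qed
  moreover have "card {..<n} - card (\<Union>y\<in>B. fibre n \<omega> y) \<le> card ({..<n} - (\<Union>y\<in>B. fibre n \<omega> y))"
    by (rule diff_card_le_card_Diff) (use \<open>finite B\<close> in simp)
  ultimately show "n - sum c B \<le> card {v. v < n \<and> pattern \<sigma> v = {}}"
    by simp
  show "pattern \<sigma> u = {}"
    using pat[OF \<open>u < n\<close>] iso by (auto simp: isolated_counts_def)
qed

lemma local_outcome_determined:
  assumes "isolated_counts n B u c \<omega>" "isolated_counts n' B u c \<omega>'" "finite B"
    "\<theta> > 0" "u < n" "u < n'" "\<theta> + sum c B \<le> n" "\<theta> + sum c B \<le> n'"
  shows "(x, u) \<in> occupied n \<theta> (\<omega> \<inter> B \<times> UNIV) \<longleftrightarrow> (x, u) \<in> occupied n' \<theta> (\<omega>' \<inter> B \<times> UNIV)"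
proof -
  note cl = isolated_counts_classes[OF assms(1,3,5)] and cl' = isolated_counts_classes[OF assms(2,3,6)]
  have "(x, u) \<in> bootstrap (vertices n) (adj n) \<theta> (\<omega> \<inter> B \<times> UNIV) t \<longleftrightarrow>
      (x, u) \<in> bootstrap (vertices n') (adj n') \<theta> (\<omega>' \<inter> B \<times> UNIV) t" for t
  proof (rule same_patterns_same_bootstrap[OF assms(4) _ _ _ assms(5,6)])
    show "\<theta> \<le> card {v. v < n \<and> pattern (\<omega> \<inter> B \<times> UNIV) v = {}}"
      using cl(2) assms(7) by linarith
    show "\<theta> \<le> card {v. v < n' \<and> pattern (\<omega>' \<inter> B \<times> UNIV) v = {}}"
      using cl'(2) assms(8) by linarith
  qed (use cl(1,3) cl'(1,3) in simp_all)
  then show ?thesis by (auto simp: bootstrap_limit_def)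
qed

section \<open>Laws of the initial counts\<close>

definition occ :: "nat \<Rightarrow> (vertex \<Rightarrow> bool) \<Rightarrow> vertex set" where
  "occ n \<eta> = {w \<in> vertices n. \<eta> w}"

lemma prob_space_initial_law: "prob_space (initial_law n p)"
  unfolding initial_law_def by (intro prob_space_PiM prob_space_measure_pmf)

lemma coordinate_measurable:
  "w \<in> vertices n \<Longrightarrow> {\<eta> \<in> space (initial_law n p). \<eta> w} \<in> sets (initial_law n p)"
  unfolding initial_law_def by (rule sets_Collect_single') auto

text \<open>That at least \<open>\<theta>\<close> neighbours are occupied is a finite union of finite intersections of occupation events.\<close>
lemma bootstrap_measurable:
  "{\<eta> \<in> space (initial_law n p). v \<in> bootstrap (vertices n) (adj n) \<theta> (occ n \<eta>) t} \<in> sets (initial_law n p)"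
proof (induction t arbitrary: v)
  case 0
  show ?case
  proof (cases "v \<in> vertices n")
    case True
    then show ?thesis using coordinate_measurable[OF True] by (simp add: occ_def)
  qed (simp add: occ_def)
next
  case (Suc t)
  let ?b = "\<lambda>\<eta>. bootstrap (vertices n) (adj n) \<theta> (occ n \<eta>) t"
  define N where "N = {S. S \<subseteq> {w. adj n v w} \<and> \<theta> \<le> card S}"
  have finN: "finite N"
    unfolding N_def by (rule finite_subset[of _ "Pow {w. adj n v w}"]) (auto simp: finite_neighbours)
  have N: "\<theta> \<le> card {w \<in> A. adj n v w} \<longleftrightarrow> (\<exists>S\<in>N. \<forall>w\<in>S. w \<in> A)" for A
  proof
    assume "\<exists>S\<in>N. \<forall>w\<in>S. w \<in> A"
    then obtain S where S: "S \<subseteq> {w \<in> A. adj n v w}" "\<theta> \<le> card S" by (auto simp: N_def)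
    have "finite {w \<in> A. adj n v w}"
      by (rule finite_subset[OF _ finite_neighbours[of n v]]) auto
    from card_mono[OF this S(1)] S(2) show "\<theta> \<le> card {w \<in> A. adj n v w}" by simp
  qed (auto simp: N_def intro!: exI[of _ "{w \<in> A. adj n v w}"])
  have "{\<eta> \<in> space (initial_law n p). v \<in> bootstrap (vertices n) (adj n) \<theta> (occ n \<eta>) (Suc t)} =
    {\<eta> \<in> space (initial_law n p). v \<in> ?b \<eta> \<or> (v \<in> vertices n \<and> (\<exists>S\<in>N. \<forall>w\<in>S. w \<in> ?b \<eta>))}"
    by (simp add: N)
  also have "\<dots> \<in> sets (initial_law n p)"
  proof (intro sets.sets_Collect_disj sets.sets_Collect_conj sets.sets_Collect_finite_Ex
      sets.sets_Collect_finite_All sets.sets_Collect_const finN Suc)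
    fix S assume "S \<in> N"
    then show "finite S" by (auto simp: N_def intro: finite_subset[OF _ finite_neighbours])
  qed
  finally show ?case .
qed

lemma occupied_measurable:
  "{\<eta> \<in> space (initial_law n p). v \<in> occupied n \<theta> (occ n \<eta>)} \<in> sets (initial_law n p)"
proof -
  have "{\<eta> \<in> space (initial_law n p). \<exists>t. v \<in> bootstrap (vertices n) (adj n) \<theta> (occ n \<eta>) t} \<in>
      sets (initial_law n p)"
    by (intro sets.sets_Collect_countable_Ex bootstrap_measurable)
  then show ?thesis by (simp add: bootstrap_limit_def)
qed

lemma prob_occupied_eq:
  "prob_occupied n \<theta> p v = measure (initial_law n p)
     {\<eta> \<in> space (initial_law n p). v \<in> occupied n \<theta> (occ n \<eta>)}"
  by (simp add: prob_occupied_def occ_def)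

lemma cylinder_prob:
  assumes "J \<subseteq> vertices n" "finite J" "0 \<le> p" "p \<le> 1"
  shows "{\<eta> \<in> space (initial_law n p). \<forall>w\<in>J. \<eta> w = X w} \<in> sets (initial_law n p)"
    and "measure (initial_law n p) {\<eta> \<in> space (initial_law n p). \<forall>w\<in>J. \<eta> w = X w} =
      (\<Prod>w\<in>J. if X w then p else 1 - p)"
proof -
  interpret product_prob_space "\<lambda>_ :: vertex. measure_pmf (bernoulli_pmf p)" "vertices n"
    by unfold_locales
  have eq: "{\<eta> \<in> space (initial_law n p). \<forall>w\<in>J. \<eta> w = X w} =
      {\<eta> \<in> space (initial_law n p). \<forall>w\<in>J. \<eta> w \<in> {X w}}" by simp
  show "{\<eta> \<in> space (initial_law n p). \<forall>w\<in>J. \<eta> w = X w} \<in> sets (initial_law n p)"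
  proof (rule sets.sets_Collect_finite_All[OF _ assms(2)])
    fix w assume "w \<in> J"
    then show "{\<eta> \<in> space (initial_law n p). \<eta> w = X w} \<in> sets (initial_law n p)"
      unfolding initial_law_def using assms(1) by (intro sets_Collect_single') auto
  qed
  have "emeasure (initial_law n p) {\<eta> \<in> space (initial_law n p). \<forall>w\<in>J. \<eta> w = X w} =
      (\<Prod>w\<in>J. emeasure (measure_pmf (bernoulli_pmf p)) {X w})"
    unfolding eq unfolding initial_law_def by (rule emeasure_PiM_Collect[OF assms(1,2)]) simp
  also have "\<dots> = (\<Prod>w\<in>J. ennreal (if X w then p else 1 - p))"
    using assms(3,4) by (intro prod.cong) (auto simp: emeasure_pmf_single)
  also have "\<dots> = ennreal (\<Prod>w\<in>J. if X w then p else 1 - p)"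
    using assms(3,4) by (intro prod_ennreal) auto
  finally show "measure (initial_law n p) {\<eta> \<in> space (initial_law n p). \<forall>w\<in>J. \<eta> w = X w} =
      (\<Prod>w\<in>J. if X w then p else 1 - p)"
    using assms(3,4) by (simp add: measure_def prod_nonneg)
qed

definition binomial_weight :: "nat \<Rightarrow> real \<Rightarrow> nat \<Rightarrow> real" where
  "binomial_weight n p k = real (n choose k) * p ^ k * (1 - p) ^ (n - k)"

definition poisson_weight :: "real \<Rightarrow> nat \<Rightarrow> real" where
  "poisson_weight a k = a ^ k / fact k * exp (- a)"

definition count_event :: "nat \<Rightarrow> real \<Rightarrow> (int \<times> int) set \<Rightarrow> (int \<times> int \<Rightarrow> nat) \<Rightarrow> (vertex \<Rightarrow> bool) set" where
  "count_event n p B c = {\<eta> \<in> space (initial_law n p). \<forall>x\<in>B. card (fibre n (occ n \<eta>) x) = c x}"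

text \<open>The event is the disjoint union, over all choices \<open>U\<close> of a set of size \<open>c x\<close> in each fibre, of the cylinder that
  prescribes these sets; summing the cylinder probabilities factorises over the fibres.\<close>
lemma count_event_prob:
  assumes "finite B" "0 \<le> p" "p \<le> 1"
  shows "count_event n p B c \<in> sets (initial_law n p)"
    and "measure (initial_law n p) (count_event n p B c) = (\<Prod>x\<in>B. binomial_weight n p (c x))"
proof -
  interpret prob_space "initial_law n p" by (rule prob_space_initial_law)
  let ?M = "initial_law n p"
  define J where "J = B \<times> {..<n}"
  define cyl where "cyl U = {\<eta> \<in> space ?M. \<forall>w\<in>J. \<eta> w = (snd w \<in> U (fst w))}" for U :: "int \<times> int \<Rightarrow> nat set"
  define \<U> where "\<U> = PiE B (\<lambda>x. {S. S \<subseteq> {..<n} \<and> card S = c x})"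
  have J: "J \<subseteq> vertices n" "finite J"
    using assms(1) by (auto simp: J_def vertices_def)
  have fin: "finite \<U>"
    unfolding \<U>_def using assms(1) by (intro finite_PiE) auto
  have fib: "fibre n (occ n \<eta>) x = {u. u < n \<and> \<eta> (x, u)}" for \<eta> x
    by (auto simp: fibre_def occ_def vertices_def)
  have cyl_iff: "\<eta> \<in> cyl U \<longleftrightarrow> \<eta> \<in> space ?M \<and> (\<forall>x\<in>B. fibre n (occ n \<eta>) x = U x)" if "U \<in> \<U>" for \<eta> U
    using that unfolding cyl_def J_def fib \<U>_def PiE_iff by auto
  have eq: "count_event n p B c = (\<Union>U\<in>\<U>. cyl U)"
  proof (rule set_eqI)
    fix \<eta>
    show "\<eta> \<in> count_event n p B c \<longleftrightarrow> \<eta> \<in> (\<Union>U\<in>\<U>. cyl U)"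
    proof
      assume "\<eta> \<in> count_event n p B c"
      then have *: "\<eta> \<in> space ?M" "\<forall>x\<in>B. card (fibre n (occ n \<eta>) x) = c x"
        by (auto simp: count_event_def)
      define U where "U = restrict (\<lambda>x. fibre n (occ n \<eta>) x) B"
      have U: "U \<in> \<U>"
        using *(2) unfolding \<U>_def U_def by (auto simp: fibre_def)
      have "\<eta> \<in> cyl U"
        unfolding cyl_iff[OF U] using *(1) by (simp add: U_def)
      with U show "\<eta> \<in> (\<Union>U\<in>\<U>. cyl U)" by blast
    next
      assume "\<eta> \<in> (\<Union>U\<in>\<U>. cyl U)"
      then obtain U where U: "U \<in> \<U>" "\<eta> \<in> cyl U" by blast
      with cyl_iff[OF U(1)] show "\<eta> \<in> count_event n p B c"
        by (auto simp: count_event_def \<U>_def)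
    qed
  qed
  have sets: "cyl U \<in> sets ?M" for U
    unfolding cyl_def using cylinder_prob(1)[OF J assms(2,3)] by simp
  show "count_event n p B c \<in> sets (initial_law n p)"
    unfolding eq using fin sets by auto
  have disj: "disjoint_family_on cyl \<U>"
    unfolding disjoint_family_on_def
  proof (intro ballI impI)
    fix U V assume UV: "U \<in> \<U>" "V \<in> \<U>" "U \<noteq> V"
    show "cyl U \<inter> cyl V = {}"
    proof (rule ccontr)
      assume "cyl U \<inter> cyl V \<noteq> {}"
      then obtain \<eta> where "\<eta> \<in> cyl U" "\<eta> \<in> cyl V" by blast
      then have "U x = V x" if "x \<in> B" for x
        using that cyl_iff[OF UV(1)] cyl_iff[OF UV(2)] by auto
      then have "U = V" using UV(1,2) unfolding \<U>_def by (intro PiE_ext) auto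
      with UV(3) show False by simp
    qed
  qed
  have "measure ?M (count_event n p B c) = (\<Sum>U\<in>\<U>. measure ?M (cyl U))"
    unfolding eq using fin sets disj by (intro finite_measure_finite_Union) auto
  also have "\<dots> = (\<Sum>U\<in>\<U>. \<Prod>x\<in>B. p ^ c x * (1 - p) ^ (n - c x))"
  proof (rule sum.cong[OF refl])
    fix U assume U: "U \<in> \<U>"
    have "measure ?M (cyl U) = (\<Prod>w\<in>J. if snd w \<in> U (fst w) then p else 1 - p)"
      unfolding cyl_def by (rule cylinder_prob(2)[OF J assms(2,3)])
    also have "\<dots> = (\<Prod>x\<in>B. \<Prod>u<n. if u \<in> U x then p else 1 - p)"
      unfolding J_def using assms(1) by (subst prod.cartesian_product) (auto simp: case_prod_beta)
    also have "\<dots> = (\<Prod>x\<in>B. p ^ c x * (1 - p) ^ (n - c x))"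
    proof (rule prod.cong[OF refl])
      fix x assume "x \<in> B"
      then have Ux: "U x \<subseteq> {..<n}" "card (U x) = c x" using U by (auto simp: \<U>_def)
      have "(\<Prod>u<n. if u \<in> U x then p else 1 - p) =
          (\<Prod>u\<in>{..<n} \<inter> U x. p) * (\<Prod>u\<in>{..<n} - U x. 1 - p)"
        by (simp add: prod.If_cases Diff_eq Compl_eq)
      also have "{..<n} \<inter> U x = U x" using Ux by auto
      also have "card ({..<n} - U x) = n - c x"
        using Ux by (subst card_Diff_subset) (auto intro: finite_subset)
      then have "(\<Prod>u\<in>{..<n} - U x. 1 - p) = (1 - p) ^ (n - c x)" by simp
      finally show "(\<Prod>u<n. if u \<in> U x then p else 1 - p) = p ^ c x * (1 - p) ^ (n - c x)"
        by (simp add: Ux(2))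
    qed
    finally show "measure ?M (cyl U) = (\<Prod>x\<in>B. p ^ c x * (1 - p) ^ (n - c x))" .
  qed
  also have "\<dots> = real (card \<U>) * (\<Prod>x\<in>B. p ^ c x * (1 - p) ^ (n - c x))"
    by simp
  also have "card \<U> = (\<Prod>x\<in>B. n choose c x)"
    unfolding \<U>_def using assms(1) by (simp add: card_PiE n_subsets)
  also have "real (\<Prod>x\<in>B. n choose c x) * (\<Prod>x\<in>B. p ^ c x * (1 - p) ^ (n - c x)) =
      (\<Prod>x\<in>B. binomial_weight n p (c x))"
    by (simp add: binomial_weight_def prod.distrib mult.assoc)
  finally show "measure ?M (count_event n p B c) = (\<Prod>x\<in>B. binomial_weight n p (c x))" .
qed

text \<open>Exceptional coincidences, of probability \<open>O(1/n)\<close> for \<open>p = a / n\<close> by a union bound.\<close>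
definition collision_event :: "nat \<Rightarrow> real \<Rightarrow> (int \<times> int) set \<Rightarrow> nat \<Rightarrow> (vertex \<Rightarrow> bool) set" where
  "collision_event n p B u = {\<eta> \<in> space (initial_law n p).
     (\<exists>y\<in>B. \<exists>z\<in>B. \<exists>v<n. y \<noteq> z \<and> \<eta> (y, v) \<and> \<eta> (z, v)) \<or> (\<exists>y\<in>B. \<eta> (y, u))}"

lemma collision_event_prob:
  assumes "finite B" "0 \<le> p" "p \<le> 1" "u < n"
  shows "collision_event n p B u \<in> sets (initial_law n p)"
    and "measure (initial_law n p) (collision_event n p B u) \<le>
      real (card (B \<times> B - Id)) * (real n * p\<^sup>2) + real (card B) * p"
proof -
  interpret prob_space "initial_law n p" by (rule prob_space_initial_law)
  let ?M = "initial_law n p"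
  let ?I = "(B \<times> B - Id) \<times> {..<n}"
  define pair where "pair w = {\<eta> \<in> space ?M. \<eta> (fst (fst w), snd w) \<and> \<eta> (snd (fst w), snd w)}"
    for w :: "((int \<times> int) \<times> int \<times> int) \<times> nat"
  define one where "one y = {\<eta> \<in> space ?M. \<eta> (y, u)}" for y
  have eq: "collision_event n p B u = (\<Union>w\<in>?I. pair w) \<union> (\<Union>y\<in>B. one y)"
  proof (intro set_eqI iffI)
    fix \<eta> assume "\<eta> \<in> collision_event n p B u"
    then consider y z v where "\<eta> \<in> space ?M" "y \<in> B" "z \<in> B" "v < n" "y \<noteq> z" "\<eta> (y, v)" "\<eta> (z, v)"
      | y where "\<eta> \<in> space ?M" "y \<in> B" "\<eta> (y, u)"
      unfolding collision_event_def by blast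
    then show "\<eta> \<in> (\<Union>w\<in>?I. pair w) \<union> (\<Union>y\<in>B. one y)"
    proof cases
      case 1
      then have "((y, z), v) \<in> ?I" "\<eta> \<in> pair ((y, z), v)" by (auto simp: pair_def)
      then show ?thesis by blast
    next
      case 2
      then have "\<eta> \<in> one y" by (simp add: one_def)
      with 2 show ?thesis by blast
    qed
  next
    fix \<eta> assume "\<eta> \<in> (\<Union>w\<in>?I. pair w) \<union> (\<Union>y\<in>B. one y)"
    then consider w where "w \<in> ?I" "\<eta> \<in> pair w" | y where "y \<in> B" "\<eta> \<in> one y" by blast
    then show "\<eta> \<in> collision_event n p B u"
    proof cases
      case 1
      obtain y z v where w: "w = ((y, z), v)" by (metis prod.exhaust)
      have "y \<in> B" "z \<in> B" "y \<noteq> z" "v < n" "\<eta> \<in> space ?M" "\<eta> (y, v)" "\<eta> (z, v)"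
        using 1 unfolding w pair_def by simp_all
      then show ?thesis unfolding collision_event_def by blast
    next
      case 2
      then show ?thesis unfolding collision_event_def one_def by blast
    qed
  qed
  have pair: "pair w \<in> sets ?M \<and> measure ?M (pair w) = p\<^sup>2" if "w \<in> ?I" for w
  proof -
    let ?J = "{(fst (fst w), snd w), (snd (fst w), snd w)}"
    have "?J \<subseteq> vertices n" "finite ?J" using that by (auto simp: vertices_def)
    note cylinder_prob[OF this assms(2,3), of "\<lambda>_. True"]
    moreover have "pair w = {\<eta> \<in> space ?M. \<forall>v\<in>?J. \<eta> v = True}" by (auto simp: pair_def)
    moreover have "(fst (fst w), snd w) \<noteq> (snd (fst w), snd w)" using that by auto
    then have "(\<Prod>v\<in>?J. if True then p else 1 - p) = p\<^sup>2" by (simp add: power2_eq_square)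
    ultimately show ?thesis by simp
  qed
  have one: "one y \<in> sets ?M \<and> measure ?M (one y) = p" if "y \<in> B" for y
  proof -
    have "{(y, u)} \<subseteq> vertices n" "finite {(y, u)}" using assms(4) by (auto simp: vertices_def)
    note cylinder_prob[OF this assms(2,3), of "\<lambda>_. True"]
    moreover have "one y = {\<eta> \<in> space ?M. \<forall>v\<in>{(y, u)}. \<eta> v = True}" by (auto simp: one_def)
    ultimately show ?thesis by simp
  qed
  have finI: "finite ?I" using assms(1) by auto
  have s1: "(\<Union>w\<in>?I. pair w) \<in> sets ?M" using pair finI by (intro sets.finite_UN) auto
  have s2: "(\<Union>y\<in>B. one y) \<in> sets ?M" using one assms(1) by (intro sets.finite_UN) auto
  show "collision_event n p B u \<in> sets ?M" unfolding eq using s1 s2 by auto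
  have "measure ?M (collision_event n p B u) \<le> measure ?M (\<Union>w\<in>?I. pair w) + measure ?M (\<Union>y\<in>B. one y)"
    unfolding eq using s1 s2 by (rule measure_Un_le)
  also have "\<dots> \<le> (\<Sum>w\<in>?I. measure ?M (pair w)) + (\<Sum>y\<in>B. measure ?M (one y))"
    using pair one finI assms(1) by (intro add_mono measure_UNION_le) auto
  also have "\<dots> = (\<Sum>w\<in>?I. p\<^sup>2) + (\<Sum>y\<in>B. p)"
    using pair one by (intro arg_cong2[of _ _ _ _ "(+)"] sum.cong) auto
  also have "\<dots> = real (card (B \<times> B - Id)) * (real n * p\<^sup>2) + real (card B) * p"
    by (simp add: card_cartesian_product)
  finally show "measure ?M (collision_event n p B u) \<le>
      real (card (B \<times> B - Id)) * (real n * p\<^sup>2) + real (card B) * p" .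
qed

lemma isolated_counts_if_no_collision:
  assumes "\<eta> \<in> count_event n p B c - collision_event n p B u"
  shows "isolated_counts n B u c (occ n \<eta>)"
proof -
  have fib: "v \<in> fibre n (occ n \<eta>) y \<longleftrightarrow> v < n \<and> \<eta> (y, v)" for v y
    by (auto simp: fibre_def occ_def vertices_def)
  have "\<eta> \<in> space (initial_law n p)" and card: "\<forall>y\<in>B. card (fibre n (occ n \<eta>) y) = c y"
    using assms by (auto simp: count_event_def)
  then have "\<not> (\<exists>y\<in>B. \<exists>z\<in>B. \<exists>v<n. y \<noteq> z \<and> \<eta> (y, v) \<and> \<eta> (z, v))" "\<not> (\<exists>y\<in>B. \<eta> (y, u))"
    using assms unfolding collision_event_def by blast+
  then show ?thesis
    unfolding isolated_counts_def using card fib by blast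
qed

text \<open>The Poisson limit theorem for a single value: \<open>(n choose k) / n\<^sup>k \<rightarrow> 1 / k!\<close> and \<open>(1 - a / n)\<^sup>n \<rightarrow> exp (- a)\<close>.\<close>
lemma binomial_weight_tendsto_poisson:
  assumes "a > 0"
  shows "(\<lambda>n. binomial_weight n (a / real n) k) \<longlonglongrightarrow> poisson_weight a k"
proof -
  have choose: "(\<lambda>n. real (n choose k) / real n ^ k) \<longlonglongrightarrow> 1 / fact k"
  proof (rule LIMSEQ_offset)
    have "(\<lambda>n. real n / real (n + k)) \<longlonglongrightarrow> 1"
    proof (rule Lim_transform_eventually)
      have "(\<lambda>n. 1 / (1 + real k * inverse (real n))) \<longlonglongrightarrow> 1 / (1 + real k * 0)"
        by (intro tendsto_intros lim_inverse_n) auto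
      then show "(\<lambda>n. 1 / (1 + real k * inverse (real n))) \<longlonglongrightarrow> 1" by simp
      show "\<forall>\<^sub>F n in sequentially. 1 / (1 + real k * inverse (real n)) = real n / real (n + k)"
        using eventually_gt_at_top[of 0] by eventually_elim (simp add: field_simps)
    qed
    from tendsto_mult[OF fact_binomial_limit[of k, where 'a = real] tendsto_power[OF this, of k]]
    have "(\<lambda>n. real ((k + n) choose n) / real (n ^ k) * (real n / real (n + k)) ^ k) \<longlonglongrightarrow> 1 / fact k"
      by simp
    then show "(\<lambda>n. real ((n + k) choose k) / real (n + k) ^ k) \<longlonglongrightarrow> 1 / fact k"
    proof (rule Lim_transform_eventually)
      show "\<forall>\<^sub>F n in sequentially. real ((k + n) choose n) / real (n ^ k) * (real n / real (n + k)) ^ k =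
          real ((n + k) choose k) / real (n + k) ^ k"
        using eventually_gt_at_top[of 0]
      proof eventually_elim
        fix n :: nat assume "n > 0"
        have "(k + n) choose n = (n + k) choose k"
          using binomial_symmetric[of n "k + n"] by (simp add: add.commute)
        then show "real ((k + n) choose n) / real (n ^ k) * (real n / real (n + k)) ^ k =
          real ((n + k) choose k) / real (n + k) ^ k"
          using \<open>n > 0\<close> by (simp add: power_divide del: of_nat_add)
      qed
    qed
  qed
  have exp: "(\<lambda>n. (1 + (- a) / real n) ^ n) \<longlonglongrightarrow> exp (- a)"
    by (rule tendsto_exp_limit_sequentially)
  have one: "(\<lambda>n. (1 - a / real n) ^ k) \<longlonglongrightarrow> (1 - 0) ^ k"
    by (intro tendsto_intros lim_const_over_n)
  have "(\<lambda>n. a ^ k * (real (n choose k) / real n ^ k) * ((1 + (- a) / real n) ^ n / (1 - a / real n) ^ k))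
      \<longlonglongrightarrow> a ^ k * (1 / fact k) * (exp (- a) / (1 - 0) ^ k)"
    by (intro tendsto_intros choose exp one) simp
  then have "(\<lambda>n. a ^ k * (real (n choose k) / real n ^ k) * ((1 + (- a) / real n) ^ n / (1 - a / real n) ^ k))
      \<longlonglongrightarrow> poisson_weight a k"
    by (simp add: poisson_weight_def)
  then show ?thesis
  proof (rule Lim_transform_eventually)
    have "\<forall>\<^sub>F n in sequentially. real n > a"
      using eventually_gt_at_top[of "nat \<lceil>a\<rceil>"] by eventually_elim linarith
    then show "\<forall>\<^sub>F n in sequentially. a ^ k * (real (n choose k) / real n ^ k) *
        ((1 + (- a) / real n) ^ n / (1 - a / real n) ^ k) = binomial_weight n (a / real n) k"
      using eventually_ge_at_top[of k]
    proof eventually_elim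
      case (elim n)
      then have "1 - a / real n > 0" using assms by (simp add: field_simps)
      then have "(1 - a / real n) ^ n / (1 - a / real n) ^ k = (1 - a / real n) ^ (n - k)"
        using elim by (simp add: power_diff)
      then show ?case by (simp add: binomial_weight_def power_divide)
    qed
  qed
qed

section \<open>Poisson estimates\<close>

lemma poisson_weight_pos: "a > 0 \<Longrightarrow> poisson_weight a k > 0"
  by (simp add: poisson_weight_def)

lemma poisson_weight_sums: "(\<lambda>k. poisson_weight a k) sums 1"
proof -
  have "(\<lambda>k. a ^ k / fact k * exp (- a)) sums (exp a * exp (- a))"
    using exp_converges[of a] by (intro sums_mult2) (simp add: divide_inverse mult.commute)
  then show ?thesis by (simp add: poisson_weight_def[abs_def] exp_minus)
qed

lemma poisson_partial_sum_tendsto: "(\<lambda>K. \<Sum>k\<le>K. poisson_weight a k) \<longlonglongrightarrow> 1"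
  using poisson_weight_sums[of a] by (simp add: sums_def_le)

lemma poisson_partial_sum_less:
  assumes "a > 0"
  shows "(\<Sum>k<m. poisson_weight a k) < 1"
proof -
  have "(\<Sum>k<m. poisson_weight a k) < (\<Sum>k<Suc m. poisson_weight a k)"
    using poisson_weight_pos[OF assms] by simp
  also have "\<dots> \<le> (\<Sum>k. poisson_weight a k)"
    using poisson_weight_sums[of a] poisson_weight_pos[OF assms]
    by (intro sum_le_suminf) (auto simp: sums_iff less_imp_le)
  also have "\<dots> = 1" using poisson_weight_sums[of a] by (simp add: sums_iff)
  finally show ?thesis .
qed

lemma continuous_poisson_weight [continuous_intros]: "continuous_on A (\<lambda>a. poisson_weight a k)"
  unfolding poisson_weight_def by (intro continuous_intros) simp

text \<open>As a function of the mean, the weight of \<open>k\<close> is largest at mean \<open>k\<close>: this is \<open>t \<le> exp (t - 1)\<close> for \<open>t = a / k\<close>,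
  raised to the power \<open>k\<close>.\<close>
lemma poisson_weight_le_mode:
  assumes "a > 0" "k > 0"
  shows "poisson_weight a k \<le> poisson_weight (real k) k"
proof -
  have "a / real k \<le> exp (a / real k - 1)"
    using exp_ge_add_one_self[of "a / real k - 1"] by simp
  then have "(a / real k) ^ k \<le> exp (a / real k - 1) ^ k"
    using assms by (intro power_mono) auto
  also have "\<dots> = exp (a - real k)"
    using assms by (simp add: exp_of_nat_mult[symmetric] right_diff_distrib)
  finally have "a ^ k \<le> real k ^ k * exp (a - real k)"
    using assms by (simp add: power_divide pos_divide_le_eq mult.commute)
  then have "a ^ k * exp (- a) \<le> real k ^ k * exp (a - real k) * exp (- a)"
    by (intro mult_right_mono) auto
  also have "\<dots> = real k ^ k * exp (- real k)"
    by (simp add: mult.assoc exp_add[symmetric])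
  finally show ?thesis
    by (simp add: poisson_weight_def divide_right_mono)
qed

text \<open>The ratio of the two weights is \<open>(1 + 1/k)\<^sup>k / e \<le> 1\<close>.\<close>
lemma poisson_mode_decreasing:
  assumes "k > 0"
  shows "poisson_weight (real (Suc k)) (Suc k) \<le> poisson_weight (real k) k"
proof -
  have "1 + 1 / real k \<le> exp (1 / real k)"
    using exp_ge_add_one_self[of "1 / real k"] by simp
  then have "(1 + 1 / real k) ^ k \<le> exp (1 / real k) ^ k"
    by (intro power_mono) auto
  also have "\<dots> = exp 1"
    using assms by (simp add: exp_of_nat_mult[symmetric])
  finally have "(real (Suc k) / real k) ^ k \<le> exp 1"
    using assms by (simp add: field_simps)
  then have "real (Suc k) ^ k \<le> real k ^ k * exp 1"
    using assms by (simp add: power_divide pos_divide_le_eq mult.commute)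
  then have "real (Suc k) ^ k * exp (- real (Suc k)) \<le> real k ^ k * exp 1 * exp (- real (Suc k))"
    by (intro mult_right_mono) auto
  also have "\<dots> = real k ^ k * exp (- real k)"
    by (simp add: mult.assoc exp_add[symmetric])
  finally have "real (Suc k) ^ k * exp (- real (Suc k)) / fact k \<le> real k ^ k * exp (- real k) / fact k"
    by (intro divide_right_mono) auto
  moreover have "poisson_weight (real (Suc k)) (Suc k) = real (Suc k) ^ k * exp (- real (Suc k)) / fact k"
    by (simp add: poisson_weight_def field_simps del: of_nat_Suc)
  ultimately show ?thesis by (simp add: poisson_weight_def)
qed

text \<open>By the two preceding lemmas it suffices to treat mean and value \<open>10\<close>, where the weight is about \<open>0.1251\<close>; the
  rational bound \<open>e \<ge> 2.71\<close> is sufficient. Here \<open>\<theta> \<ge> 14\<close> enters, through \<open>\<theta> - 4 \<ge> 10\<close>.\<close>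
lemma poisson_weight_le:
  assumes "a > 0" "k \<ge> 10"
  shows "poisson_weight a k \<le> 13/100"
proof -
  have "poisson_weight (real k) k \<le> poisson_weight (real 10) 10"
    using assms(2)
  proof (induction rule: dec_induct)
    case (step m)
    then show ?case using poisson_mode_decreasing[of m] by linarith
  qed simp
  also have "\<dots> \<le> 13/100"
  proof -
    have "(221/200 :: real) \<le> exp (1/10)"
      using exp_lower_Taylor_quadratic[of "1/10"] by (simp add: power2_eq_square)
    then have "(221/200 :: real) ^ 10 \<le> exp (1/10) ^ 10"
      by (intro power_mono) auto
    also have "exp (1/10) ^ 10 = exp (1::real)"
      by (simp add: exp_of_nat_mult[symmetric])
    finally have "(271/100 :: real) \<le> exp 1" by (simp add: power_divide)
    then have "(271/100 :: real) ^ 10 \<le> exp 1 ^ 10" by (intro power_mono) auto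
    also have "exp 1 ^ 10 = exp (10::real)" by (simp add: exp_of_nat_mult[symmetric])
    finally have "(271/100 :: real) ^ 10 \<le> exp 10" .
    then have "10 ^ 10 \<le> (13/100) * fact 10 * exp (10::real)"
      by (simp add: fact_numeral power_divide)
    then show ?thesis
      by (simp add: poisson_weight_def exp_minus field_simps)
  qed
  finally show ?thesis
    using poisson_weight_le_mode[of a k] assms by linarith
qed

text \<open>The window has three points, and the weight of each is bounded uniformly in the mean.\<close>
lemma poisson_window:
  assumes "a > 0" "\<theta> \<ge> 14"
  shows "(\<Sum>k\<in>{\<theta> - 4..\<theta> - 2}. poisson_weight a k) \<le> 39/100"
proof -
  have "(\<Sum>k\<in>{\<theta> - 4..\<theta> - 2}. poisson_weight a k) \<le> (\<Sum>k\<in>{\<theta> - 4..\<theta> - 2}. 13/100)"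
    using assms by (intro sum_mono poisson_weight_le) auto
  also have "\<dots> = real (card {\<theta> - 4..\<theta> - 2}) * (13/100)" by simp
  also have "card {\<theta> - 4..\<theta> - 2} = 3" using assms by simp
  finally show ?thesis by simp
qed

definition count_weight :: "(int \<times> int) set \<Rightarrow> real \<Rightarrow> (int \<times> int \<Rightarrow> nat) \<Rightarrow> real" where
  "count_weight B a c = (\<Prod>y\<in>B. poisson_weight a (c y))"

text \<open>Truncation at \<open>K\<close> leaves finitely many possibilities, so that limits can be taken term by term.\<close>
definition bounded_counts :: "(int \<times> int) set \<Rightarrow> nat \<Rightarrow> (int \<times> int \<Rightarrow> nat) set" where
  "bounded_counts B K = PiE B (\<lambda>_. {..K})"

lemma finite_bounded_counts [simp]: "finite B \<Longrightarrow> finite (bounded_counts B K)"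
  unfolding bounded_counts_def by (intro finite_PiE) auto

lemma count_weight_nonneg: "a > 0 \<Longrightarrow> 0 \<le> count_weight B a c"
  unfolding count_weight_def by (intro prod_nonneg) (auto intro: less_imp_le poisson_weight_pos)

lemma continuous_count_weight [continuous_intros]: "continuous_on A (\<lambda>a. count_weight B a c)"
  unfolding count_weight_def by (intro continuous_intros)

lemma sum_count_weight:
  assumes "finite B"
  shows "(\<Sum>c\<in>bounded_counts B K. count_weight B a c) = (\<Sum>k\<le>K. poisson_weight a k) ^ card B"
  unfolding bounded_counts_def count_weight_def
  using prod_sum_PiE[OF assms, of "\<lambda>_. {..K}" "\<lambda>_. poisson_weight a"] by simp

text \<open>The sum over all count vectors factorises over \<open>B\<close>; the factors outside \<open>S\<close> are at most \<open>1\<close>.\<close>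
lemma sum_count_weight_constrained:
  assumes "finite B" "S \<subseteq> B" "a > 0" "finite T"
  shows "(\<Sum>c\<in>{c \<in> bounded_counts B K. \<forall>y\<in>S. c y \<in> T}. count_weight B a c) \<le>
    (\<Sum>k\<in>T. poisson_weight a k) ^ card S"
proof -
  let ?A = "\<lambda>y. if y \<in> S then {..K} \<inter> T else {..K}"
  have "{c \<in> bounded_counts B K. \<forall>y\<in>S. c y \<in> T} = PiE B ?A"
  proof (intro set_eqI iffI)
    fix c assume "c \<in> {c \<in> bounded_counts B K. \<forall>y\<in>S. c y \<in> T}"
    then show "c \<in> PiE B ?A" unfolding bounded_counts_def by (auto simp: PiE_iff)
  next
    fix c assume c: "c \<in> PiE B ?A"
    then have "c y \<in> T" if "y \<in> S" for y
      using PiE_mem[OF c, of y] that assms(2) by auto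
    moreover have "c y \<le> K" if "y \<in> B" for y
      using PiE_mem[OF c that] by (auto split: if_splits)
    ultimately show "c \<in> {c \<in> bounded_counts B K. \<forall>y\<in>S. c y \<in> T}"
      using c unfolding bounded_counts_def by (auto simp: PiE_iff)
  qed
  then have "(\<Sum>c\<in>{c \<in> bounded_counts B K. \<forall>y\<in>S. c y \<in> T}. count_weight B a c) =
      (\<Prod>y\<in>B. \<Sum>k\<in>?A y. poisson_weight a k)"
    unfolding count_weight_def using prod_sum_PiE[OF assms(1), of ?A "\<lambda>_. poisson_weight a"] by simp
  also have "\<dots> \<le> (\<Prod>y\<in>B. if y \<in> S then (\<Sum>k\<in>T. poisson_weight a k) else 1)"
  proof (rule prod_mono)
    fix y assume "y \<in> B"
    have nonneg: "0 \<le> poisson_weight a k" for k using poisson_weight_pos[OF assms(3)] by (rule less_imp_le)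
    have "(\<Sum>k\<in>{..K} \<inter> T. poisson_weight a k) \<le> (\<Sum>k\<in>T. poisson_weight a k)"
      using assms(4) nonneg by (intro sum_mono2) auto
    moreover have "(\<Sum>k\<le>K. poisson_weight a k) \<le> 1"
      using poisson_partial_sum_less[OF assms(3), of "Suc K"] by (simp add: lessThan_Suc_atMost)
    ultimately show "0 \<le> (\<Sum>k\<in>?A y. poisson_weight a k) \<and>
        (\<Sum>k\<in>?A y. poisson_weight a k) \<le> (if y \<in> S then (\<Sum>k\<in>T. poisson_weight a k) else 1)"
      using nonneg by (auto intro!: sum_nonneg)
  qed
  also have "\<dots> = (\<Prod>y\<in>B \<inter> S. (\<Sum>k\<in>T. poisson_weight a k))"
    using assms(1) by (simp add: prod.If_cases Collect_conj_eq)
  also have "B \<inter> S = S" using assms(2) by auto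
  finally show ?thesis by simp
qed

section \<open>Local approximation of the occupation probability\<close>

text \<open>Only lower bounds are needed: applied to an event and to its complement, they bound the probability of the event
  from both sides. The counts are jointly Poisson in the limit and collisions cost \<open>err n \<rightarrow> 0\<close>.\<close>
lemma isolated_counts_lower_bound:
  assumes "a > 0" "finite B" "finite F" "F \<subseteq> extensional B"
    and meas: "\<And>n. {\<eta> \<in> space (initial_law n (a / real n)). Q n \<eta>} \<in> sets (initial_law n (a / real n))"
    and imp: "\<forall>\<^sub>F n in sequentially. \<forall>c\<in>F. \<forall>\<eta>. isolated_counts n B u c (occ n \<eta>) \<longrightarrow> Q n \<eta>"
    and "\<delta> > 0"
  shows "\<forall>\<^sub>F n in sequentially. (\<Sum>c\<in>F. count_weight B a c) - \<delta> \<le>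
    measure (initial_law n (a / real n)) {\<eta> \<in> space (initial_law n (a / real n)). Q n \<eta>}"
proof -
  define err where "err n = real (card (B \<times> B - Id)) * (real n * (a / real n)\<^sup>2) + real (card B) * (a / real n)" for n
  \<comment> \<open>A collision is charged once for the whole disjoint union of count events, not once for each \<open>c\<close>.\<close>
  define g where "g n = (\<Sum>c\<in>F. \<Prod>x\<in>B. binomial_weight n (a / real n) (c x)) - err n" for n
  have "(\<lambda>n. real (card (B \<times> B - Id)) * (a * (a / real n)) + real (card B) * (a / real n)) \<longlonglongrightarrow>
      real (card (B \<times> B - Id)) * (a * 0) + real (card B) * 0"
    by (intro tendsto_intros lim_const_over_n)
  then have "(\<lambda>n. real (card (B \<times> B - Id)) * (a * (a / real n)) + real (card B) * (a / real n)) \<longlonglongrightarrow> 0"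
    by simp
  then have "err \<longlonglongrightarrow> 0"
  proof (rule Lim_transform_eventually)
    show "\<forall>\<^sub>F n in sequentially. real (card (B \<times> B - Id)) * (a * (a / real n)) + real (card B) * (a / real n) = err n"
      using eventually_gt_at_top[of 0]
      by eventually_elim (simp add: err_def power2_eq_square)
  qed
  then have "g \<longlonglongrightarrow> (\<Sum>c\<in>F. count_weight B a c) - 0"
    unfolding g_def count_weight_def
    by (intro tendsto_diff tendsto_sum tendsto_prod binomial_weight_tendsto_poisson assms)
  then have "\<forall>\<^sub>F n in sequentially. (\<Sum>c\<in>F. count_weight B a c) - \<delta> < g n"
    using assms(7) by (intro order_tendstoD(1)) auto
  moreover have "\<forall>\<^sub>F n in sequentially. a / real n \<le> 1"
    using eventually_gt_at_top[of "nat \<lceil>a\<rceil>"]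
  proof eventually_elim
    case (elim n)
    then have "a < real n" by linarith
    then show ?case using assms(1) by simp
  qed
  moreover note imp eventually_gt_at_top[of u]
  ultimately show ?thesis
  proof eventually_elim
    case (elim n)
    let ?p = "a / real n"
    let ?M = "initial_law n ?p"
    interpret prob_space ?M by (rule prob_space_initial_law)
    have p: "0 \<le> ?p" "?p \<le> 1" using assms(1) elim(2) by auto
    have disj: "disjoint_family_on (count_event n ?p B) F"
      unfolding disjoint_family_on_def
    proof (intro ballI impI)
      fix c d assume cd: "c \<in> F" "d \<in> F" "c \<noteq> d"
      show "count_event n ?p B c \<inter> count_event n ?p B d = {}"
      proof (rule ccontr)
        assume "count_event n ?p B c \<inter> count_event n ?p B d \<noteq> {}"
        then have "c x = d x" if "x \<in> B" for x using that by (auto simp: count_event_def)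
        then have "c = d" using cd(1,2) assms(4) by (intro extensionalityI[of c B d]) auto
        with cd(3) show False by simp
      qed
    qed
    have "(\<Sum>c\<in>F. \<Prod>x\<in>B. binomial_weight n ?p (c x)) = (\<Sum>c\<in>F. measure ?M (count_event n ?p B c))"
      using count_event_prob(2)[OF assms(2) p] by simp
    also have "\<dots> = measure ?M (\<Union>c\<in>F. count_event n ?p B c)"
      using count_event_prob(1)[OF assms(2) p] assms(3) disj
      by (intro finite_measure_finite_Union[symmetric]) auto
    also have "\<dots> \<le> measure ?M ({\<eta> \<in> space ?M. Q n \<eta>} \<union> collision_event n ?p B u)"
    proof (rule finite_measure_mono)
      show "(\<Union>c\<in>F. count_event n ?p B c) \<subseteq> {\<eta> \<in> space ?M. Q n \<eta>} \<union> collision_event n ?p B u"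
      proof
        fix \<eta> assume "\<eta> \<in> (\<Union>c\<in>F. count_event n ?p B c)"
        then obtain c where c: "c \<in> F" "\<eta> \<in> count_event n ?p B c" by blast
        show "\<eta> \<in> {\<eta> \<in> space ?M. Q n \<eta>} \<union> collision_event n ?p B u"
        proof (cases "\<eta> \<in> collision_event n ?p B u")
          case False
          then have "Q n \<eta>"
            using elim(3) c isolated_counts_if_no_collision[of \<eta> n ?p B c u] by blast
          then show ?thesis using c(2) by (simp add: count_event_def)
        qed simp
      qed
      show "{\<eta> \<in> space ?M. Q n \<eta>} \<union> collision_event n ?p B u \<in> sets ?M"
        using meas collision_event_prob(1)[OF assms(2) p elim(4)] by auto
    qed
    also have "\<dots> \<le> measure ?M {\<eta> \<in> space ?M. Q n \<eta>} + measure ?M (collision_event n ?p B u)"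
      using meas collision_event_prob(1)[OF assms(2) p elim(4)] by (intro measure_Un_le) auto
    also have "measure ?M (collision_event n ?p B u) \<le> err n"
      unfolding err_def by (rule collision_event_prob(2)[OF assms(2) p elim(4)])
    finally have "g n \<le> measure ?M {\<eta> \<in> space ?M. Q n \<eta>}" by (simp add: g_def)
    with elim(1) show ?case by linarith
  qed
qed

text \<open>The outcome of the local process as a property of the counts alone; \<open>n\<close> must be large enough to leave \<open>\<theta>\<close>
  coordinates that are unused above \<open>B\<close>.\<close>
definition locally_occupied ::
  "nat \<Rightarrow> (int \<times> int) set \<Rightarrow> int \<times> int \<Rightarrow> nat \<Rightarrow> (int \<times> int \<Rightarrow> nat) \<Rightarrow> bool" where
  "locally_occupied \<theta> B x u c \<longleftrightarrow> (\<exists>n \<omega>. u < n \<and> \<theta> + sum c B \<le> n \<and> isolated_counts n B u c \<omega> \<and>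
     (x, u) \<in> occupied n \<theta> (\<omega> \<inter> B \<times> UNIV))"

definition crossable :: "nat \<Rightarrow> nat \<Rightarrow> int \<times> int \<Rightarrow> (int \<times> int \<Rightarrow> nat) \<Rightarrow> bool" where
  "crossable \<theta> R x c \<longleftrightarrow> (\<exists>p\<in>path_codes x R. passable_code \<theta> R c x p)"

lemma uncrossable_outcome:
  assumes "\<theta> \<ge> 5" "R \<ge> 1" "u < n" "\<theta> + sum c (l1ball x R) \<le> n"
    and iso: "isolated_counts n (l1ball x R) u c \<omega>"
    and "\<not> locally_occupied \<theta> (l1ball x R) x u c" "\<not> crossable \<theta> R x c"
  shows "(x, u) \<notin> occupied n \<theta> \<omega>"
proof
  assume occ: "(x, u) \<in> occupied n \<theta> \<omega>"
  have "(x, u) \<notin> occupied n \<theta> (\<omega> \<inter> l1ball x R \<times> UNIV)"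
    using assms(3-6) unfolding locally_occupied_def by blast
  then obtain z where z: "influence_path \<theta> R (\<lambda>y. card (fibre n \<omega> y)) x z"
    using iso by (elim far_influence_needs_path[OF assms(1-3) _ occ, rotated])
      (auto simp: isolated_counts_def)
  then have "influence_path \<theta> R c x z"
    using iso by (auto simp: influence_path_def isolated_counts_def)
  from influence_path_coded[OF this assms(2)] assms(7) show False
    by (simp add: crossable_def)
qed

definition lower_approx :: "nat \<Rightarrow> nat \<Rightarrow> nat \<Rightarrow> int \<times> int \<Rightarrow> nat \<Rightarrow> real \<Rightarrow> real" where
  "lower_approx \<theta> R K x u a = (\<Sum>c\<in>{c \<in> bounded_counts (l1ball x R) K.
     locally_occupied \<theta> (l1ball x R) x u c}. count_weight (l1ball x R) a c)"

text \<open>For isolated counts that are not crossable, local and global outcome coincide. Crossable counts, and counts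
  exceeding \<open>K\<close>, are treated as if they led to occupation.\<close>
definition upper_approx :: "nat \<Rightarrow> nat \<Rightarrow> nat \<Rightarrow> int \<times> int \<Rightarrow> nat \<Rightarrow> real \<Rightarrow> real" where
  "upper_approx \<theta> R K x u a = 1 - (\<Sum>c\<in>{c \<in> bounded_counts (l1ball x R) K.
     \<not> locally_occupied \<theta> (l1ball x R) x u c \<and> \<not> crossable \<theta> R x c}. count_weight (l1ball x R) a c)"

lemma approx_bounds:
  assumes "\<theta> \<ge> 5" "R \<ge> 1" "a > 0" "\<delta> > 0"
  shows "\<forall>\<^sub>F n in sequentially. lower_approx \<theta> R K x u a - \<delta> \<le> prob_occupied n \<theta> (a / real n) (x, u)"
    and "\<forall>\<^sub>F n in sequentially. prob_occupied n \<theta> (a / real n) (x, u) \<le> upper_approx \<theta> R K x u a + \<delta>"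
proof -
  let ?B = "l1ball x R"
  have sum_le: "sum c ?B \<le> K * card ?B" if "c \<in> bounded_counts ?B K" for c
    using sum_bounded_above[of ?B c K] that by (auto simp: bounded_counts_def PiE_iff mult.commute)
  have ev: "\<forall>\<^sub>F n in sequentially. u < n \<and> \<theta> + K * card ?B \<le> n"
    using eventually_gt_at_top[of u] eventually_ge_at_top[of "\<theta> + K * card ?B"] by eventually_elim simp
  have ext: "{c \<in> bounded_counts ?B K. P c} \<subseteq> extensional ?B" for P
    by (auto simp: bounded_counts_def PiE_iff)
  have fin: "finite {c \<in> bounded_counts ?B K. P c}" for P
    by (rule finite_subset[of _ "bounded_counts ?B K"]) auto
  show "\<forall>\<^sub>F n in sequentially. lower_approx \<theta> R K x u a - \<delta> \<le> prob_occupied n \<theta> (a / real n) (x, u)"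
    unfolding lower_approx_def prob_occupied_eq
  proof (rule isolated_counts_lower_bound[OF assms(3) finite_l1ball fin ext occupied_measurable _ assms(4)])
    show "\<forall>\<^sub>F n in sequentially. \<forall>c\<in>{c \<in> bounded_counts ?B K. locally_occupied \<theta> ?B x u c}.
        \<forall>\<eta>. isolated_counts n ?B u c (occ n \<eta>) \<longrightarrow> (x, u) \<in> occupied n \<theta> (occ n \<eta>)"
      using ev
    proof eventually_elim
      case (elim n)
      show ?case
      proof (intro ballI allI impI)
        fix c \<eta> assume c: "c \<in> {c \<in> bounded_counts ?B K. locally_occupied \<theta> ?B x u c}"
          and iso: "isolated_counts n ?B u c (occ n \<eta>)"
        then obtain n' \<omega> where n': "u < n'" "\<theta> + sum c ?B \<le> n'" "isolated_counts n' ?B u c \<omega>"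
          "(x, u) \<in> occupied n' \<theta> (\<omega> \<inter> ?B \<times> UNIV)"
          unfolding locally_occupied_def by blast
        have "(x, u) \<in> occupied n \<theta> (occ n \<eta> \<inter> ?B \<times> UNIV)"
          using local_outcome_determined[OF n'(3) iso finite_l1ball, of \<theta> x] n' elim sum_le[of c] c assms(1)
          by auto
        then show "(x, u) \<in> occupied n \<theta> (occ n \<eta>)"
          using occupied_mono[of "occ n \<eta> \<inter> ?B \<times> UNIV" "occ n \<eta>" n \<theta>] by blast
      qed
    qed
  qed
  let ?F = "{c \<in> bounded_counts ?B K. \<not> locally_occupied \<theta> ?B x u c \<and> \<not> crossable \<theta> R x c}"
  have compl: "{\<eta> \<in> space (initial_law n p). (x, u) \<notin> occupied n \<theta> (occ n \<eta>)} =
      space (initial_law n p) - {\<eta> \<in> space (initial_law n p). (x, u) \<in> occupied n \<theta> (occ n \<eta>)}" for n p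
    by blast
  have "\<forall>\<^sub>F n in sequentially. (\<Sum>c\<in>?F. count_weight ?B a c) - \<delta> \<le> measure (initial_law n (a / real n))
      {\<eta> \<in> space (initial_law n (a / real n)). (x, u) \<notin> occupied n \<theta> (occ n \<eta>)}"
  proof (rule isolated_counts_lower_bound[OF assms(3) finite_l1ball fin ext _ _ assms(4)])
    show "{\<eta> \<in> space (initial_law n (a / real n)). (x, u) \<notin> occupied n \<theta> (occ n \<eta>)} \<in>
        sets (initial_law n (a / real n))" for n
      unfolding compl by (intro sets.compl_sets occupied_measurable)
    show "\<forall>\<^sub>F n in sequentially. \<forall>c\<in>?F. \<forall>\<eta>. isolated_counts n ?B u c (occ n \<eta>) \<longrightarrow>
        (x, u) \<notin> occupied n \<theta> (occ n \<eta>)"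
      using ev
    proof eventually_elim
      case (elim n)
      show ?case
      proof (intro ballI allI impI)
        fix c \<eta> assume c: "c \<in> ?F" and iso: "isolated_counts n ?B u c (occ n \<eta>)"
        have "\<theta> + sum c ?B \<le> n" using sum_le[of c] c elim by auto
        then show "(x, u) \<notin> occupied n \<theta> (occ n \<eta>)"
          using uncrossable_outcome[OF assms(1,2) _ _ iso] elim c by blast
      qed
    qed
  qed
  then show "\<forall>\<^sub>F n in sequentially. prob_occupied n \<theta> (a / real n) (x, u) \<le> upper_approx \<theta> R K x u a + \<delta>"
  proof eventually_elim
    case (elim n)
    then show ?case
      unfolding compl prob_occupied_eq upper_approx_def
        prob_space.prob_compl[OF prob_space_initial_law occupied_measurable]
      by linarith
  qed
qed

lemma sum_UN_le:
  fixes f :: "'a \<Rightarrow> real"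
  assumes "finite I" "\<And>i. i \<in> I \<Longrightarrow> finite (A i)" "\<And>x. 0 \<le> f x"
  shows "sum f (\<Union>i\<in>I. A i) \<le> (\<Sum>i\<in>I. sum f (A i))"
  using assms(1,2)
proof (induction I rule: finite_induct)
  case (insert i I)
  then have "sum f (A i \<union> (\<Union>j\<in>I. A j)) + sum f (A i \<inter> (\<Union>j\<in>I. A j)) = sum f (A i) + sum f (\<Union>j\<in>I. A j)"
    by (intro sum.union_inter) auto
  moreover have "0 \<le> sum f (A i \<inter> (\<Union>j\<in>I. A j))" using assms(3) by (intro sum_nonneg)
  ultimately show ?case using insert by simp
qed simp

text \<open>Each of the at most \<open>6 \<cdot> (5/2)\<^sup>R\<close> codes prescribes \<open>R + 1\<close> independent counts to lie in the window, so the total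
  weight is at most \<open>6 \<cdot> (5/2 \<cdot> 39/100)\<^sup>R\<close>, and \<open>5/2 \<cdot> 39/100 = 39/40\<close>.\<close>
lemma crossable_weight:
  assumes "\<theta> \<ge> 14" "R \<ge> 1" "a > 0"
  shows "(\<Sum>c\<in>{c \<in> bounded_counts (l1ball x R) K. crossable \<theta> R x c}. count_weight (l1ball x R) a c) \<le>
    6 * (39/40) ^ R"
proof -
  let ?B = "l1ball x R"
  let ?F = "bounded_counts ?B K"
  let ?T = "{\<theta> - 4..\<theta> - 2}"
  have finF: "finite ?F" by simp
  have each: "(\<Sum>c\<in>{c \<in> ?F. passable_code \<theta> R c x p}. count_weight ?B a c) \<le> (39/100) ^ R" for p
  proof (cases "distinct p \<and> length p = Suc R \<and> set p \<subseteq> ?B")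
    case True
    then have "{c \<in> ?F. passable_code \<theta> R c x p} = {c \<in> ?F. \<forall>y\<in>set p. c y \<in> ?T}"
      by (simp add: passable_code_def)
    then have "(\<Sum>c\<in>{c \<in> ?F. passable_code \<theta> R c x p}. count_weight ?B a c) \<le>
        (\<Sum>k\<in>?T. poisson_weight a k) ^ card (set p)"
      using True assms(3) sum_count_weight_constrained[of ?B "set p" a ?T K] by simp
    also have "card (set p) = Suc R" using True by (simp add: distinct_card)
    also have "(\<Sum>k\<in>?T. poisson_weight a k) ^ Suc R \<le> (39/100) ^ Suc R"
      using poisson_window[OF assms(3,1)] poisson_weight_pos[OF assms(3)]
      by (intro power_mono sum_nonneg) (auto intro: less_imp_le)
    also have "\<dots> \<le> (39/100 :: real) ^ R" by simp
    finally show ?thesis .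
  next
    case False
    then have "{c \<in> ?F. passable_code \<theta> R c x p} = {}" by (auto simp: passable_code_def)
    then show ?thesis by (simp only: sum.empty) simp
  qed
  have "{c \<in> ?F. crossable \<theta> R x c} = (\<Union>p\<in>path_codes x R. {c \<in> ?F. passable_code \<theta> R c x p})"
    by (auto simp: crossable_def)
  then have "(\<Sum>c\<in>{c \<in> ?F. crossable \<theta> R x c}. count_weight ?B a c) =
      (\<Sum>c\<in>(\<Union>p\<in>path_codes x R. {c \<in> ?F. passable_code \<theta> R c x p}). count_weight ?B a c)"
    by simp
  also have "\<dots> \<le> (\<Sum>p\<in>path_codes x R. \<Sum>c\<in>{c \<in> ?F. passable_code \<theta> R c x p}. count_weight ?B a c)"
    using finite_path_codes finF count_weight_nonneg[OF assms(3)] by (intro sum_UN_le) auto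
  also have "\<dots> \<le> (\<Sum>p\<in>path_codes x R. (39/100) ^ R)"
    by (intro sum_mono each)
  also have "\<dots> = real (card (path_codes x R)) * (39/100) ^ R" by simp
  also have "\<dots> \<le> 6 * (5/2) ^ R * (39/100) ^ R"
    using card_path_codes[OF assms(2)] by (intro mult_right_mono) auto
  also have "\<dots> = 6 * (39/40) ^ R"
    by (simp add: power_mult_distrib[symmetric])
  finally show ?thesis .
qed

text \<open>The gap consists of the crossable counts, made rare by a large radius, and the counts beyond the truncation, made
  rare by a large \<open>K\<close> once the radius is fixed.\<close>
lemma approx_gap_small:
  assumes "\<theta> \<ge> 14" "a > 0" "\<epsilon> > 0"
  obtains R K where "R \<ge> 1" "upper_approx \<theta> R K x u a - lower_approx \<theta> R K x u a < \<epsilon>"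
proof -
  have lim_R: "(\<lambda>R. 6 * (39/40 :: real) ^ R) \<longlonglongrightarrow> 6 * 0"
    by (intro tendsto_intros LIMSEQ_power_zero) simp
  have "\<forall>\<^sub>F R in sequentially. 6 * (39/40 :: real) ^ R < \<epsilon> / 2"
    by (rule order_tendstoD(2)[OF lim_R]) (use assms(3) in simp)
  from eventually_conj[OF this eventually_ge_at_top[of 1]]
  obtain R where R: "6 * (39/40 :: real) ^ R < \<epsilon> / 2" "R \<ge> 1"
    by (auto simp: eventually_sequentially)
  let ?B = "l1ball x R"
  have lim_K: "(\<lambda>K. (\<Sum>k\<le>K. poisson_weight a k) ^ card ?B) \<longlonglongrightarrow> 1 ^ card ?B"
    by (intro tendsto_power poisson_partial_sum_tendsto)
  have "\<forall>\<^sub>F K in sequentially. 1 - \<epsilon> / 2 < (\<Sum>k\<le>K. poisson_weight a k) ^ card ?B"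
    by (rule order_tendstoD(1)[OF lim_K]) (use assms(3) in simp)
  then obtain K where K: "1 - \<epsilon> / 2 < (\<Sum>k\<le>K. poisson_weight a k) ^ card ?B"
    by (auto simp: eventually_sequentially)
  let ?F = "bounded_counts ?B K"
  let ?w = "count_weight ?B a"
  let ?E = "\<lambda>c. locally_occupied \<theta> ?B x u c" and ?H = "\<lambda>c. crossable \<theta> R x c"
  have fin: "finite {c \<in> ?F. P c}" for P by (rule finite_subset[of _ ?F]) auto
  have total: "sum ?w ?F = (\<Sum>k\<le>K. poisson_weight a k) ^ card ?B"
    by (rule sum_count_weight) simp
  define s where "s P = sum ?w {c \<in> ?F. P c}" for P
  have split: "s P = s (\<lambda>c. P c \<and> Q c) + s (\<lambda>c. P c \<and> \<not> Q c)" for P Q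
  proof -
    have "{c \<in> ?F. P c} = {c \<in> ?F. P c \<and> Q c} \<union> {c \<in> ?F. P c \<and> \<not> Q c}" by blast
    then show ?thesis
      unfolding s_def using sum.union_disjoint[OF fin fin, of "\<lambda>c. P c \<and> Q c" "\<lambda>c. P c \<and> \<not> Q c" ?w] by auto
  qed
  have "s (\<lambda>c. \<not> ?E c \<and> ?H c) \<le> s ?H"
    unfolding s_def by (rule sum_mono2[OF fin]) (blast, rule count_weight_nonneg[OF assms(2)])
  also have "\<dots> \<le> 6 * (39/40) ^ R"
    unfolding s_def by (rule crossable_weight[OF assms(1) R(2) assms(2)])
  finally have crossing: "s (\<lambda>c. \<not> ?E c \<and> ?H c) \<le> 6 * (39/40) ^ R" .
  have "sum ?w ?F = s (\<lambda>_. True)" by (simp add: s_def)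
  also have "\<dots> = s ?E + (s (\<lambda>c. \<not> ?E c \<and> ?H c) + s (\<lambda>c. \<not> ?E c \<and> \<not> ?H c))"
    using split[of "\<lambda>_. True" ?E] split[of "\<lambda>c. \<not> ?E c" ?H] by simp
  finally have "upper_approx \<theta> R K x u a - lower_approx \<theta> R K x u a < \<epsilon>"
    using R(1) K total crossing
    unfolding upper_approx_def lower_approx_def s_def[symmetric] by linarith
  with R(2) show thesis by (rule that)
qed

section \<open>Convergence and continuity\<close>

text \<open>The approximating functions may depend on \<open>a\<close> and \<open>\<epsilon>\<close>. The one pair chosen at \<open>a\<close> bounds the limit everywhere, and by
  continuity its gap stays small near \<open>a\<close>; hence pointwise small gaps suffice.\<close>
lemma continuous_limit_from_approximations:
  fixes P :: "real \<Rightarrow> nat \<Rightarrow> real"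
  assumes "\<And>a \<epsilon>. a > 0 \<Longrightarrow> \<epsilon> > 0 \<Longrightarrow> \<exists>f g. continuous_on {0<..} f \<and> continuous_on {0<..} g \<and> g a - f a < \<epsilon> \<and>
    (\<forall>b>0. \<forall>\<delta>>0. \<forall>\<^sub>F n in sequentially. f b - \<delta> \<le> P b n \<and> P b n \<le> g b + \<delta>)"
  shows "\<exists>L. (\<forall>a>0. P a \<longlonglongrightarrow> L a) \<and> continuous_on {0<..} L"
proof -
  have "convergent (P a)" if a: "a > 0" for a
  proof -
    have "Cauchy (P a)"
    proof (rule metric_CauchyI)
      fix e :: real assume "e > 0"
      then obtain f g where fg: "g a - f a < e / 2"
        "\<forall>b>0. \<forall>\<delta>>0. \<forall>\<^sub>F n in sequentially. f b - \<delta> \<le> P b n \<and> P b n \<le> g b + \<delta>"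
        using assms[OF a, of "e / 2"] by auto
      have "\<forall>\<^sub>F n in sequentially. f a - e / 8 \<le> P a n \<and> P a n \<le> g a + e / 8"
        using fg(2) a \<open>e > 0\<close> by simp
      then obtain N where N: "\<And>n. n \<ge> N \<Longrightarrow> f a - e / 8 \<le> P a n \<and> P a n \<le> g a + e / 8"
        by (auto simp: eventually_sequentially)
      have "dist (P a m) (P a n) < e" if "m \<ge> N" "n \<ge> N" for m n
        using N[OF that(1)] N[OF that(2)] fg(1) \<open>e > 0\<close> unfolding dist_real_def by linarith
      then show "\<exists>N. \<forall>m\<ge>N. \<forall>n\<ge>N. dist (P a m) (P a n) < e" by blast
    qed
    then show ?thesis by (simp add: Cauchy_convergent_iff)
  qed
  then have L: "P a \<longlonglongrightarrow> lim (P a)" if "a > 0" for a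
    using that by (simp add: convergent_LIMSEQ_iff)
  have "continuous_on {0<..} (\<lambda>a. lim (P a))"
  proof (rule continuous_at_imp_continuous_on, rule ballI)
    fix a :: real assume "a \<in> {0<..}"
    then have a: "a > 0" by simp
    show "isCont (\<lambda>a. lim (P a)) a"
      unfolding isCont_def
    proof (rule tendstoI)
      fix e :: real assume "e > 0"
      then obtain f g where cont: "continuous_on {0<..} f" "continuous_on {0<..} g" and gap: "g a - f a < e / 2"
        and bd: "\<forall>b>0. \<forall>\<delta>>0. \<forall>\<^sub>F n in sequentially. f b - \<delta> \<le> P b n \<and> P b n \<le> g b + \<delta>"
        using assms[OF a, of "e / 2"] by auto
      have between: "f b \<le> lim (P b) \<and> lim (P b) \<le> g b" if "b > 0" for b
      proof
        show "f b \<le> lim (P b)"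
        proof (rule field_le_epsilon)
          fix \<delta> :: real assume "\<delta> > 0"
          then have "\<forall>\<^sub>F n in sequentially. f b - \<delta> \<le> P b n"
            using bd that by (simp add: eventually_conj_iff)
          from tendsto_lowerbound[OF L[OF that] this] show "f b \<le> lim (P b) + \<delta>" by simp
        qed
        show "lim (P b) \<le> g b"
        proof (rule field_le_epsilon)
          fix \<delta> :: real assume "\<delta> > 0"
          then have "\<forall>\<^sub>F n in sequentially. P b n \<le> g b + \<delta>"
            using bd that by (simp add: eventually_conj_iff)
          from tendsto_upperbound[OF L[OF that] this] show "lim (P b) \<le> g b + \<delta>" by simp
        qed
      qed
      have "isCont f a" "isCont g a"
        using cont a by (auto simp: continuous_on_eq_continuous_at)
      then have "(f \<longlongrightarrow> f a) (at a)" "(g \<longlongrightarrow> g a) (at a)"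
        by (auto simp: isCont_def)
      then have "\<forall>\<^sub>F b in at a. f a - e / 4 < f b" "\<forall>\<^sub>F b in at a. g b < g a + e / 4"
        using \<open>e > 0\<close> by (auto intro: order_tendstoD)
      moreover have "\<forall>\<^sub>F b in at a. b > 0"
        using a by (intro order_tendstoD(1)[OF tendsto_ident_at])
      ultimately show "\<forall>\<^sub>F b in at a. dist (lim (P b)) (lim (P a)) < e"
      proof eventually_elim
        case (elim b)
        with between[OF a] between[OF elim(3)] gap show ?case
          unfolding dist_real_def by linarith
      qed
    qed
  qed
  with L show ?thesis
    by (intro exI[of _ "\<lambda>a. lim (P a)"] conjI allI impI)
qed

lemma occupation_probability_converges:
  assumes "\<theta> \<ge> 14"
  shows "\<exists>L. (\<forall>a>0. (\<lambda>n. prob_occupied n \<theta> (a / real n) v) \<longlonglongrightarrow> L a) \<and> continuous_on {0<..} L"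
proof (rule continuous_limit_from_approximations)
  obtain x u where v: "v = (x, u)" by fastforce
  fix a \<epsilon> :: real assume a: "a > 0" "\<epsilon> > 0"
  obtain R K where RK: "R \<ge> 1" "upper_approx \<theta> R K x u a - lower_approx \<theta> R K x u a < \<epsilon>"
    using approx_gap_small[OF assms a] by blast
  have cont: "continuous_on {0<..} (lower_approx \<theta> R K x u)" "continuous_on {0<..} (upper_approx \<theta> R K x u)"
    unfolding lower_approx_def[abs_def] upper_approx_def[abs_def] by (intro continuous_intros)+
  show "\<exists>f g. continuous_on {0<..} f \<and> continuous_on {0<..} g \<and> g a - f a < \<epsilon> \<and>
    (\<forall>b>0. \<forall>\<delta>>0. \<forall>\<^sub>F n in sequentially. f b - \<delta> \<le> prob_occupied n \<theta> (b / real n) v \<and>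
       prob_occupied n \<theta> (b / real n) v \<le> g b + \<delta>)"
    unfolding v
  proof (rule exI[of _ "lower_approx \<theta> R K x u"], rule exI[of _ "upper_approx \<theta> R K x u"],
      intro conjI allI impI cont RK(2) eventually_conj)
    fix b \<delta> :: real assume "b > 0" "\<delta> > 0"
    then show "\<forall>\<^sub>F n in sequentially. lower_approx \<theta> R K x u b - \<delta> \<le> prob_occupied n \<theta> (b / real n) (x, u)"
      "\<forall>\<^sub>F n in sequentially. prob_occupied n \<theta> (b / real n) (x, u) \<le> upper_approx \<theta> R K x u b + \<delta>"
      using assms RK(1) by (intro approx_bounds; simp)+
  qed
qed

section \<open>Crude bounds for all thresholds\<close>

lemma eventually_valid_density:
  assumes "a > 0"
  shows "\<forall>\<^sub>F n in sequentially. 0 \<le> a / real n \<and> a / real n \<le> 1"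
  using eventually_gt_at_top[of "nat \<lceil>a\<rceil>"]
proof eventually_elim
  case (elim n)
  then have "a < real n" by linarith
  then show ?case using assms by simp
qed

lemma occupation_lower_bound:
  assumes "a > 0"
  shows "ereal (1 - (\<Sum>k<\<theta>. poisson_weight a k)) \<le> liminf (\<lambda>n. ereal (prob_occupied n \<theta> (a / real n) v))"
proof -
  obtain x u where v: "v = (x, u)" by fastforce
  let ?g = "\<lambda>n. 1 - (\<Sum>k<\<theta>. binomial_weight n (a / real n) k)"
  have "(\<lambda>n. ereal (?g n)) \<longlonglongrightarrow> ereal (1 - (\<Sum>k<\<theta>. poisson_weight a k))"
    unfolding lim_ereal by (intro tendsto_intros binomial_weight_tendsto_poisson assms)
  then have "liminf (\<lambda>n. ereal (?g n)) = ereal (1 - (\<Sum>k<\<theta>. poisson_weight a k))"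
    by (intro lim_imp_Liminf) auto
  moreover have "liminf (\<lambda>n. ereal (?g n)) \<le> liminf (\<lambda>n. ereal (prob_occupied n \<theta> (a / real n) v))"
  proof (rule Liminf_mono)
    show "\<forall>\<^sub>F n in sequentially. ereal (?g n) \<le> ereal (prob_occupied n \<theta> (a / real n) v)"
      using eventually_valid_density[OF assms] eventually_gt_at_top[of u]
    proof eventually_elim
      case (elim n)
      let ?p = "a / real n" and ?c = "\<lambda>k. \<lambda>_ :: int \<times> int. k"
      let ?M = "initial_law n ?p"
      interpret prob_space ?M by (rule prob_space_initial_law)
      let ?A = "{\<eta> \<in> space ?M. (x, u) \<in> occupied n \<theta> (occ n \<eta>)}"
      have c: "count_event n ?p {x} (?c k) \<in> sets ?M"
        "measure ?M (count_event n ?p {x} (?c k)) = binomial_weight n ?p k" for k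
        using count_event_prob[of "{x}" ?p n "?c k"] elim(1) by auto
      have "1 = measure ?M (space ?M)" by (simp add: prob_space)
      also have "\<dots> \<le> measure ?M (?A \<union> (\<Union>k<\<theta>. count_event n ?p {x} (?c k)))"
      proof (rule finite_measure_mono)
        show "space ?M \<subseteq> ?A \<union> (\<Union>k<\<theta>. count_event n ?p {x} (?c k))"
        proof
          fix \<eta> assume \<eta>: "\<eta> \<in> space ?M"
          show "\<eta> \<in> ?A \<union> (\<Union>k<\<theta>. count_event n ?p {x} (?c k))"
          proof (cases "\<theta> \<le> card (fibre n (occ n \<eta>) x)")
            case True
            then show ?thesis using fibre_initially_full[OF True elim(2)] \<eta> by simp
          next
            case False
            then have "\<eta> \<in> count_event n ?p {x} (?c (card (fibre n (occ n \<eta>) x)))"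
              using \<eta> by (simp add: count_event_def)
            with False show ?thesis by (meson UN_I UnI2 lessThan_iff not_le)
          qed
        qed
      qed (use c occupied_measurable in auto)
      also have "\<dots> \<le> measure ?M ?A + measure ?M (\<Union>k<\<theta>. count_event n ?p {x} (?c k))"
        using c(1) occupied_measurable by (intro measure_Un_le sets.finite_UN) auto
      also have "measure ?M (\<Union>k<\<theta>. count_event n ?p {x} (?c k)) \<le> (\<Sum>k<\<theta>. binomial_weight n ?p k)"
        unfolding c(2)[symmetric] using c(1) by (intro measure_UNION_le) auto
      finally show ?case by (simp add: prob_occupied_eq v)
    qed
  qed
  ultimately show ?thesis by simp
qed

lemma occupation_upper_bound:
  assumes "a > 0" "\<theta> \<ge> 3"
  shows "limsup (\<lambda>n. ereal (prob_occupied n \<theta> (a / real n) v)) \<le> ereal (1 - exp (- a) ^ card (square (fst v)))"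
proof -
  obtain x u where v: "v = (x, u)" by fastforce
  let ?g = "\<lambda>n. 1 - (\<Prod>y\<in>square x. binomial_weight n (a / real n) 0)"
  have fin: "finite (square x)" by (simp add: square_def)
  have "(\<lambda>n. ereal (?g n)) \<longlonglongrightarrow> ereal (1 - (\<Prod>y\<in>square x. poisson_weight a 0))"
    unfolding lim_ereal by (intro tendsto_intros binomial_weight_tendsto_poisson assms)
  then have "limsup (\<lambda>n. ereal (?g n)) = ereal (1 - exp (- a) ^ card (square x))"
    by (intro lim_imp_Limsup) (auto simp: poisson_weight_def)
  moreover have "limsup (\<lambda>n. ereal (prob_occupied n \<theta> (a / real n) v)) \<le> limsup (\<lambda>n. ereal (?g n))"
  proof (rule Limsup_mono)
    show "\<forall>\<^sub>F n in sequentially. ereal (prob_occupied n \<theta> (a / real n) v) \<le> ereal (?g n)"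
      using eventually_valid_density[OF assms(1)] eventually_gt_at_top[of u]
    proof eventually_elim
      case (elim n)
      let ?p = "a / real n"
      let ?M = "initial_law n ?p"
      interpret prob_space ?M by (rule prob_space_initial_law)
      let ?A = "{\<eta> \<in> space ?M. (x, u) \<in> occupied n \<theta> (occ n \<eta>)}"
      let ?E = "count_event n ?p (square x) (\<lambda>_. 0)"
      have E: "?E \<in> sets ?M" "measure ?M ?E = (\<Prod>y\<in>square x. binomial_weight n ?p 0)"
        using count_event_prob[OF fin, of ?p n "\<lambda>_. 0"] elim(1) by auto
      have "?A \<subseteq> space ?M - ?E"
      proof
        fix \<eta> assume A: "\<eta> \<in> ?A"
        have "\<eta> \<notin> ?E"
        proof
          assume "\<eta> \<in> ?E"
          then have "fibre n (occ n \<eta>) y = {}" if "y \<in> square x" for y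
            using that by (simp add: count_event_def)
          from empty_square_stays_empty[OF assms(2) this elim(2)] A show False by simp
        qed
        with A show "\<eta> \<in> space ?M - ?E" by simp
      qed
      then have "measure ?M ?A \<le> measure ?M (space ?M - ?E)"
        using E(1) by (intro finite_measure_mono) auto
      also have "\<dots> = ?g n" using prob_compl[OF E(1)] E(2) by simp
      finally show ?case by (simp add: prob_occupied_eq v)
    qed
  qed
  ultimately show ?thesis by (simp add: v)
qed

lemma poisson_weight_vanishes_at_top: "((\<lambda>a. poisson_weight a k) \<longlongrightarrow> 0) at_top"
proof -
  have "((\<lambda>a :: real. a ^ k / exp a / fact k) \<longlongrightarrow> 0 / fact k) at_top"
    by (intro tendsto_divide tendsto_power_div_exp_0 tendsto_const) simp
  then show ?thesis
    by (simp add: poisson_weight_def[abs_def] exp_minus field_simps)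
qed

theorem theorem1p3:
  fixes \<theta> :: nat and v\<^sub>0 :: vertex
  assumes "\<theta> \<ge> 3"
  defines "P \<equiv> \<lambda>(a::real) (n::nat). prob_occupied n \<theta> (a / real n) v\<^sub>0"
  shows "(\<forall>a>0. liminf (\<lambda>n. ereal (P a n)) \<in> {0<..<1} \<and>
                limsup (\<lambda>n. ereal (P a n)) \<in> {0<..<1}) \<and>
         ((\<lambda>a. liminf (\<lambda>n. ereal (P a n))) \<longlongrightarrow> 0) (at_right 0) \<and>
         ((\<lambda>a. limsup (\<lambda>n. ereal (P a n))) \<longlongrightarrow> 0) (at_right 0) \<and>
         ((\<lambda>a. liminf (\<lambda>n. ereal (P a n))) \<longlongrightarrow> 1) at_top \<and>
         ((\<lambda>a. limsup (\<lambda>n. ereal (P a n))) \<longlongrightarrow> 1) at_top \<and>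
         (\<theta> \<ge> 14 \<longrightarrow>
           (\<exists>L::real \<Rightarrow> real. (\<forall>a>0. P a \<longlonglongrightarrow> L a) \<and> continuous_on {0<..} L))"
proof -
  let ?m = "card (square (fst v\<^sub>0))"
  define linf where "linf a = liminf (\<lambda>n. ereal (P a n))" for a
  define lsup where "lsup a = limsup (\<lambda>n. ereal (P a n))" for a
  define lo where "lo a = 1 - (\<Sum>k<\<theta>. poisson_weight a k)" for a
  define hi where "hi a = 1 - exp (- a) ^ ?m" for a :: real
  have lo: "ereal (lo a) \<le> linf a" and hi: "lsup a \<le> ereal (hi a)" if "a > 0" for a
    using occupation_lower_bound[OF that] occupation_upper_bound[OF that assms(1)]
    by (auto simp: linf_def lsup_def lo_def hi_def P_def)
  have inf_sup: "linf a \<le> lsup a" for a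
    unfolding linf_def lsup_def by (rule Liminf_le_Limsup) simp
  have lo_pos: "0 < lo a" if "a > 0" for a
    using poisson_partial_sum_less[OF that] by (simp add: lo_def)
  have hi_less: "hi a < 1" for a by (simp add: hi_def)
  have bounds: "ereal (lo a) \<le> linf a" "linf a \<le> ereal (hi a)" "ereal (lo a) \<le> lsup a" "lsup a \<le> ereal (hi a)"
    if "a > 0" for a
    using lo[OF that] hi[OF that] inf_sup[of a] by auto
  have range: "\<forall>a>0. linf a \<in> {0<..<1} \<and> lsup a \<in> {0<..<1}"
  proof (intro allI impI)
    fix a :: real assume a: "a > 0"
    have "0 < ereal (lo a)" "ereal (hi a) < 1" using lo_pos[OF a] hi_less by auto
    then show "linf a \<in> {0<..<1} \<and> lsup a \<in> {0<..<1}"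
      using bounds[OF a] by (meson greaterThanLessThan_iff less_le_trans le_less_trans)
  qed
  have near_0: "\<forall>\<^sub>F a :: real in at_right 0. a > 0"
    by (rule eventually_at_right_less)
  have "(hi \<longlongrightarrow> 1 - exp (- 0) ^ ?m) (at_right 0)"
    unfolding hi_def[abs_def] by (intro tendsto_intros)
  then have "(hi \<longlongrightarrow> 0) (at_right 0)" by simp
  then have hi_0: "((\<lambda>a. ereal (hi a)) \<longlongrightarrow> 0) (at_right 0)"
    by (simp add: zero_ereal_def)
  have inf_0: "(linf \<longlongrightarrow> 0) (at_right 0)"
  proof (rule tendsto_sandwich[OF _ _ tendsto_const hi_0])
    show "\<forall>\<^sub>F a in at_right 0. 0 \<le> linf a" "\<forall>\<^sub>F a in at_right 0. linf a \<le> ereal (hi a)"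
      using near_0 by (eventually_elim; use range bounds in force)+
  qed
  have sup_0: "(lsup \<longlongrightarrow> 0) (at_right 0)"
  proof (rule tendsto_sandwich[OF _ _ tendsto_const hi_0])
    show "\<forall>\<^sub>F a in at_right 0. 0 \<le> lsup a" "\<forall>\<^sub>F a in at_right 0. lsup a \<le> ereal (hi a)"
      using near_0 by (eventually_elim; use range bounds in force)+
  qed
  have at_inf: "\<forall>\<^sub>F a :: real in at_top. a > 0"
    by (rule eventually_gt_at_top)
  have "(lo \<longlongrightarrow> 1 - (\<Sum>k<\<theta>. 0)) at_top"
    unfolding lo_def[abs_def] by (intro tendsto_intros poisson_weight_vanishes_at_top)
  then have lo_inf: "((\<lambda>a. ereal (lo a)) \<longlongrightarrow> 1) at_top"
    by (simp add: one_ereal_def)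
  have inf_1: "(linf \<longlongrightarrow> 1) at_top"
  proof (rule tendsto_sandwich[OF _ _ lo_inf tendsto_const])
    show "\<forall>\<^sub>F a in at_top. ereal (lo a) \<le> linf a" "\<forall>\<^sub>F a in at_top. linf a \<le> 1"
      using at_inf by (eventually_elim; use range bounds in force)+
  qed
  have sup_1: "(lsup \<longlongrightarrow> 1) at_top"
  proof (rule tendsto_sandwich[OF _ _ lo_inf tendsto_const])
    show "\<forall>\<^sub>F a in at_top. ereal (lo a) \<le> lsup a" "\<forall>\<^sub>F a in at_top. lsup a \<le> 1"
      using at_inf by (eventually_elim; use range bounds in force)+
  qed
  have conv: "\<theta> \<ge> 14 \<longrightarrow> (\<exists>L::real \<Rightarrow> real. (\<forall>a>0. P a \<longlonglongrightarrow> L a) \<and> continuous_on {0<..} L)"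
    unfolding P_def using occupation_probability_converges by blast
  show ?thesis
    using range inf_0 sup_0 inf_1 sup_1 conv unfolding linf_def[abs_def] lsup_def[abs_def] by blast
qed

end
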